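(* Let $G$ be a unimodular locally compact second countable Hausdorff topological group, $\mathcal{H}$ a separable complex Hilbert space, $U\colon G\to\mathcal{U}(\mathcal{H})$ a square integrable (irreducible) projective representation, and $\mu_G$ the Haar measure on $G$ normalized in agreement with $U$. Let $\boldsymbol{G}=G\times G$, $\mu_{\boldsymbol{G}}=\mu_G\otimes\mu_G$, let $\hat T\in\mathcal{B}_2(\mathcal{H})$ with $\|\hat T\|_{\mathcal{B}_2(\mathcal{H})}=1$, and put $\hat T(\boldsymbol{g}):=U(g_1)\hat T\,U(g_2)^*$ for $\boldsymbol{g}=(g_1,g_2)\in\boldsymbol{G}$. Let $\mathfrak{D}_{\hat T}\colon\mathcal{B}_2(\mathcal{H})\to\mathrm{L}^2(\boldsymbol{G},\mu_{\boldsymbol{G}};\mathbb{C})$ be the isometry $(\mathfrak{D}_{\hat T}\hat A)(\boldsymbol{g})=\langle\hat T(\boldsymbol{g}),\hat A\rangle_{\mathcal{B}_2(\mathcal{H})}$, let $\mathfrak{Q}_{\hat T}$ be its adjoint, and define the star product $$\Phi_1\star\Phi_2:=\mathfrak{D}_{\hat T}\big((\mathfrak{Q}_{\hat T}\Phi_1)(\mathfrak{Q}_{\hat T}\Phi_2)\big),\qquad\Phi_1,\Phi_2\in\mathrm{L}^2(\boldsymbol{G},\mu_{\boldsymbol{G}};\mathbb{C}).$$ Then, for all $\Phi_1,\Phi_2\in\mathrm{L}^2(\boldsymbol{G},\mu_{\boldsymbol{G}};\mathbb{C})$ and $\mu_{\boldsymbol{G}}$-almost all $\boldsymbol{g}\in\boldsymbol{G}$,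 $$\big(\Phi_1\star\Phi_2\big)(\boldsymbol{g})=\int_{\boldsymbol{G}}\mathrm{d}\mu_{\boldsymbol{G}}(\boldsymbol{g}')\int_{\boldsymbol{G}}\mathrm{d}\mu_{\boldsymbol{G}}(\boldsymbol{g}'')\;\kappa_{\hat T}(\boldsymbol{g},\boldsymbol{g}',\boldsymbol{g}'')\,\Phi_1(\boldsymbol{g}')\,\Phi_2(\boldsymbol{g}''),$$ where $\kappa_{\hat T}(\boldsymbol{g},\boldsymbol{g}',\boldsymbol{g}''):=\mathrm{tr}\big(\hat T(\boldsymbol{g})^*\,\hat T(\boldsymbol{g}')\,\hat T(\boldsymbol{g}'')\big)$. In particular, for all $\hat A_1,\hat A_2\in\mathcal{B}_2(\mathcal{H})$, with $A_i=\mathfrak{D}_{\hat T}\hat A_i$, $$\big(\mathfrak{D}_{\hat T}(\hat A_1\hat A_2)\big)(\boldsymbol{g})=\int_{\boldsymbol{G}}\mathrm{d}\mu_{\boldsymbol{G}}(\boldsymbol{g}')\int_{\boldsymbol{G}}\mathrm{d}\mu_{\boldsymbol{G}}(\boldsymbol{g}'')\;\kappa_{\hat T}(\boldsymbol{g},\boldsymbol{g}',\boldsymbol{g}'')\,A_1(\boldsymbol{g}')\,A_2(\boldsymbol{g}'')$$ for $\mu_{\boldsymbol{G}}$-almost all $\boldsymbol{g}\in\boldsymbol{G}$.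
   Context: Scalar products are linear in the second argument. $\mathcal{B}_2(\mathcal{H})$ is the Hilbert space of Hilbert-Schmidt operators with $\langle\hat A,\hat B\rangle_{\mathcal{B}_2(\mathcal{H})}=\mathrm{tr}(\hat A^*\hat B)$. Double integrals are iterated integrals (inner integral performed first). Projective representation of $G$ in $\mathcal{H}$: a map $U\colon G\to\mathcal{U}(\mathcal{H})$ (unitary group) such that $g\mapsto\langle\phi,U(g)\psi\rangle$ is Borel for all $\phi,\psi\in\mathcal{H}$, $U(e)=I$, and $U(gh)=\mathtt{m}(g,h)U(g)U(h)$ for all $g,h\in G$, for some Borel function $\mathtt{m}\colon G\times G\to\mathbb{T}$ (the multiplier). An irreducible projective representation $U$ is square integrable if there exist nonzero $\psi,\phi\in\mathcal{H}$ with $g\mapsto\langle U(g)\psi,\phi\rangle$ in $\mathrm{L}^2(G,\mu_G;\mathbb{C})$. Known fact (Duflo-Moore): if $G$ is unimodular and $U$ is square integrable, then there is a number $d_U>0$, depending on the normalization of the Haar measure $\mu_G$, such that $\int_G\langle\phi_1,U(g)\psi_1\rangle\langle U(g)\psi_2,\phi_2\rangle\,\mathrm{d}\mu_G(g)=d_U^2\,\langle\phi_1,\phi_2\rangle\langle\psi_2,\psi_1\rangle$ for all $\phi_1,\phi_2,\psi_1,\psi_2\in\mathcal{H}$. The Haar measure is normalized in agreement with $U$ if $d_U=1$. *)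

theory Defs
  imports "HOL-Analysis.Analysis"
begin

section \<open>Complex Hilbert spaces\<close>

text \<open>
  The library only has real inner product spaces. A complex inner product is added on top of the
  underlying real Hilbert space, whose inner product is its real part; positivity and the norm are
  thereby inherited from \<^class>\<open>real_inner\<close>. Scalar products are linear in the second argument.
\<close>

class complex_inner = real_inner +
  fixes scaleC :: "complex \<Rightarrow> 'a \<Rightarrow> 'a" (infixr "*\<^sub>C" 75)
    and cinner :: "'a \<Rightarrow> 'a \<Rightarrow> complex"
  assumes scaleC_add_right: "c *\<^sub>C (x + y) = c *\<^sub>C x + c *\<^sub>C y"
    and scaleC_add_left: "(c + d) *\<^sub>C x = c *\<^sub>C x + d *\<^sub>C x"
    and scaleC_scaleC: "c *\<^sub>C d *\<^sub>C x = (c * d) *\<^sub>C x"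
    and scaleC_of_real: "complex_of_real r *\<^sub>C x = r *\<^sub>R x"
    and cinner_commute: "cinner x y = cnj (cinner y x)"
    and cinner_add_right: "cinner x (y + z) = cinner x y + cinner x z"
    and cinner_scaleC_right: "cinner x (c *\<^sub>C y) = c * cinner x y"
    and inner_eq_Re_cinner: "inner x y = Re (cinner x y)"

class complex_hilbert = complex_inner + complete_space


section \<open>Operators\<close>

definition clinear :: "('h::complex_inner \<Rightarrow> 'h) \<Rightarrow> bool"
  where "clinear A \<longleftrightarrow> (\<forall>x y. A (x + y) = A x + A y) \<and> (\<forall>c x. A (c *\<^sub>C x) = c *\<^sub>C A x)"

definition bounded_clinear :: "('h::complex_inner \<Rightarrow> 'h) \<Rightarrow> bool"
  where "bounded_clinear A \<longleftrightarrow> clinear A \<and> (\<exists>K. \<forall>x. norm (A x) \<le> K * norm x)"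

definition cadjoint :: "('h::complex_hilbert \<Rightarrow> 'h) \<Rightarrow> 'h \<Rightarrow> 'h"
  where "cadjoint A = (THE A'. \<forall>x y. cinner (A' x) y = cinner x (A y))"

definition unitary_op :: "('h::complex_hilbert \<Rightarrow> 'h) \<Rightarrow> bool"
  where "unitary_op A \<longleftrightarrow> clinear A \<and> surj A \<and> (\<forall>x y. cinner (A x) (A y) = cinner x y)"

definition orthonormal_basis :: "('h::complex_hilbert) set \<Rightarrow> bool"
  where "orthonormal_basis B \<longleftrightarrow>
    (\<forall>x\<in>B. \<forall>y\<in>B. cinner x y = (if x = y then 1 else 0)) \<and>
    (\<forall>x. (\<forall>e\<in>B. cinner e x = 0) \<longrightarrow> x = 0)"

text \<open>
  For trace class operators (in particular for products of two Hilbert-Schmidt operators) the series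
  converges absolutely and its sum does not depend on the basis.
\<close>

definition trace_op :: "('h::complex_hilbert \<Rightarrow> 'h) \<Rightarrow> complex"
  where "trace_op A = (\<Sum>\<^sub>\<infinity>e\<in>(SOME B. orthonormal_basis B). cinner e (A e))"

definition hilbert_schmidt :: "('h::complex_hilbert \<Rightarrow> 'h) \<Rightarrow> bool"
  where "hilbert_schmidt A \<longleftrightarrow> bounded_clinear A \<and>
    (\<exists>B. orthonormal_basis B \<and> (\<lambda>e. (norm (A e))\<^sup>2) summable_on B)"

definition hs_inner :: "('h::complex_hilbert \<Rightarrow> 'h) \<Rightarrow> ('h \<Rightarrow> 'h) \<Rightarrow> complex"
  where "hs_inner A B = trace_op (cadjoint A \<circ> B)"

definition hs_norm :: "('h::complex_hilbert \<Rightarrow> 'h) \<Rightarrow> real"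
  where "hs_norm A = sqrt (Re (hs_inner A A))"


section \<open>Haar measure and square integrable functions\<close>

text \<open>
  Groups are written additively, since \<^class>\<open>topological_group_add\<close> is the library's class of
  topological groups; \<^class>\<open>group_add\<close> does not assume commutativity. On a second countable locally
  compact Hausdorff space a Borel measure that is finite on compact sets is automatically regular.
\<close>

definition haar_measure :: "'g::{topological_group_add,second_countable_topology,t2_space} measure \<Rightarrow> bool"
  where "haar_measure \<mu> \<longleftrightarrow> sets \<mu> = sets borel \<and> emeasure \<mu> UNIV \<noteq> 0 \<and>
    (\<forall>K. compact K \<longrightarrow> emeasure \<mu> K < \<infinity>) \<and>
    (\<forall>g. \<forall>A\<in>sets borel. emeasure \<mu> ((\<lambda>x. g + x) ` A) = emeasure \<mu> A)"

definition unimodular :: "'g::{topological_group_add,second_countable_topology,t2_space} itself \<Rightarrow> bool"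
  where "unimodular _ \<longleftrightarrow> (\<forall>\<mu> :: 'g measure. haar_measure \<mu> \<longrightarrow>
    (\<forall>g. \<forall>A\<in>sets borel. emeasure \<mu> ((\<lambda>x. x + g) ` A) = emeasure \<mu> A))"

text \<open>Elements of the complex space \<open>L\<^sup>2\<close> are given by representatives.\<close>

definition L2 :: "'a measure \<Rightarrow> ('a \<Rightarrow> complex) set"
  where "L2 M = {f \<in> borel_measurable M. integrable M (\<lambda>x. (cmod (f x))\<^sup>2)}"

definition L2_inner :: "'a measure \<Rightarrow> ('a \<Rightarrow> complex) \<Rightarrow> ('a \<Rightarrow> complex) \<Rightarrow> complex"
  where "L2_inner M f h = (LINT x|M. cnj (f x) * h x)"

text \<open>
  Existence of the iterated integral (inner integral over the second argument). This has to be
  stated separately because the Bochner integral of a non-integrable function is 0.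
\<close>

definition iterated_integrable :: "'a measure \<Rightarrow> ('a \<Rightarrow> 'a \<Rightarrow> complex) \<Rightarrow> bool"
  where "iterated_integrable M F \<longleftrightarrow>
    (AE x in M. integrable M (F x)) \<and> integrable M (\<lambda>x. LINT y|M. F x y)"


section \<open>Projective representations\<close>

definition projective_rep ::
    "('g::{topological_group_add,second_countable_topology,t2_space} \<Rightarrow> 'h::complex_hilbert \<Rightarrow> 'h) \<Rightarrow> bool"
  where "projective_rep U \<longleftrightarrow>
    (\<forall>g. unitary_op (U g)) \<and>
    (\<forall>\<phi> \<psi>. (\<lambda>g. cinner \<phi> (U g \<psi>)) \<in> borel_measurable borel) \<and>
    U 0 = id \<and>
    (\<exists>m :: 'g \<times> 'g \<Rightarrow> complex. m \<in> borel_measurable borel \<and> (\<forall>p. cmod (m p) = 1) \<and>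
      (\<forall>g h \<psi>. U (g + h) \<psi> = m (g, h) *\<^sub>C U g (U h \<psi>)))"

definition closed_csubspace :: "('h::complex_hilbert) set \<Rightarrow> bool"
  where "closed_csubspace S \<longleftrightarrow> closed S \<and> 0 \<in> S \<and>
    (\<forall>x\<in>S. \<forall>y\<in>S. x + y \<in> S) \<and> (\<forall>c. \<forall>x\<in>S. c *\<^sub>C x \<in> S)"

definition irreducible_rep :: "('g \<Rightarrow> 'h::complex_hilbert \<Rightarrow> 'h) \<Rightarrow> bool"
  where "irreducible_rep U \<longleftrightarrow> (UNIV :: 'h set) \<noteq> {0} \<and>
    (\<forall>S. closed_csubspace S \<and> (\<forall>g. U g ` S \<subseteq> S) \<longrightarrow> S = {0} \<or> S = UNIV)"

definition square_integrable_rep ::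
    "'g::{topological_group_add,second_countable_topology,t2_space} measure \<Rightarrow>
      ('g \<Rightarrow> 'h::complex_hilbert \<Rightarrow> 'h) \<Rightarrow> bool"
  where "square_integrable_rep \<mu> U \<longleftrightarrow> projective_rep U \<and> irreducible_rep U \<and>
    (\<exists>\<psi> \<phi>. \<psi> \<noteq> 0 \<and> \<phi> \<noteq> 0 \<and> (\<lambda>g. cinner (U g \<psi>) \<phi>) \<in> L2 \<mu>)"

text \<open>The number \<open>d\<close> in the Duflo-Moore orthogonality relations of a unimodular group.\<close>

definition duflo_moore_const ::
    "'g measure \<Rightarrow> ('g \<Rightarrow> 'h::complex_hilbert \<Rightarrow> 'h) \<Rightarrow> real \<Rightarrow> bool"
  where "duflo_moore_const \<mu> U d \<longleftrightarrow> d > 0 \<and>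
    (\<forall>\<phi>\<^sub>1 \<phi>\<^sub>2 \<psi>\<^sub>1 \<psi>\<^sub>2. has_bochner_integral \<mu>
      (\<lambda>g. cinner \<phi>\<^sub>1 (U g \<psi>\<^sub>1) * cinner (U g \<psi>\<^sub>2) \<phi>\<^sub>2)
      (complex_of_real (d\<^sup>2) * cinner \<phi>\<^sub>1 \<phi>\<^sub>2 * cinner \<psi>\<^sub>2 \<psi>\<^sub>1))"

definition normalized_in_agreement ::
    "'g measure \<Rightarrow> ('g \<Rightarrow> 'h::complex_hilbert \<Rightarrow> 'h) \<Rightarrow> bool"
  where "normalized_in_agreement \<mu> U \<longleftrightarrow> duflo_moore_const \<mu> U 1"


section \<open>Quantization, dequantization and the star product\<close>

definition translate ::
    "('g \<Rightarrow> 'h::complex_hilbert \<Rightarrow> 'h) \<Rightarrow> ('h \<Rightarrow> 'h) \<Rightarrow> 'g \<times> 'g \<Rightarrow> 'h \<Rightarrow> 'h"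
  where "translate U T g = U (fst g) \<circ> T \<circ> cadjoint (U (snd g))"

definition dequantize ::
    "('g \<Rightarrow> 'h::complex_hilbert \<Rightarrow> 'h) \<Rightarrow> ('h \<Rightarrow> 'h) \<Rightarrow> ('h \<Rightarrow> 'h) \<Rightarrow> 'g \<times> 'g \<Rightarrow> complex"
  where "dequantize U T A g = hs_inner (translate U T g) A"

text \<open>The Hilbert space adjoint of \<open>dequantize U T\<close>.\<close>

definition quantize ::
    "'g measure \<Rightarrow> ('g \<Rightarrow> 'h::complex_hilbert \<Rightarrow> 'h) \<Rightarrow> ('h \<Rightarrow> 'h) \<Rightarrow> ('g \<times> 'g \<Rightarrow> complex) \<Rightarrow> 'h \<Rightarrow> 'h"
  where "quantize \<mu> U T \<Phi> = (THE A. hilbert_schmidt A \<and>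
    (\<forall>B. hilbert_schmidt B \<longrightarrow> hs_inner B A = L2_inner (\<mu> \<Otimes>\<^sub>M \<mu>) (dequantize U T B) \<Phi>))"

definition star_product ::
    "'g measure \<Rightarrow> ('g \<Rightarrow> 'h::complex_hilbert \<Rightarrow> 'h) \<Rightarrow> ('h \<Rightarrow> 'h) \<Rightarrow>
      ('g \<times> 'g \<Rightarrow> complex) \<Rightarrow> ('g \<times> 'g \<Rightarrow> complex) \<Rightarrow> 'g \<times> 'g \<Rightarrow> complex"
  where "star_product \<mu> U T \<Phi>\<^sub>1 \<Phi>\<^sub>2 =
    dequantize U T (quantize \<mu> U T \<Phi>\<^sub>1 \<circ> quantize \<mu> U T \<Phi>\<^sub>2)"

definition star_kernel ::
    "('g \<Rightarrow> 'h::complex_hilbert \<Rightarrow> 'h) \<Rightarrow> ('h \<Rightarrow> 'h) \<Rightarrow> 'g \<times> 'g \<Rightarrow> 'g \<times> 'g \<Rightarrow> 'g \<times> 'g \<Rightarrow> complex"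
  where "star_kernel U T g g' g'' =
    trace_op (cadjoint (translate U T g) \<circ> translate U T g' \<circ> translate U T g'')"

end

(* Both integrals in the star product are values of the adjoint of the dequantization map D.
   By cyclicity of the trace, kappa(g,g',g'') is the conjugate of D(T(g')^* T(g)) at g'', so that
   pairing with Phi_2 gives <T(g')^* T(g), Q Phi_2> = <T(g) (Q Phi_2)^*, T(g')>, and pairing this
   with Phi_1 gives <T(g) (Q Phi_2)^*, Q Phi_1> = <T(g), (Q Phi_1)(Q Phi_2)>. Hence the identity
   holds for every g. What remains is that D maps into L^2 and is isometric: for finite rank
   operators this is Fubini together with the orthogonality relations, Fatou's lemma extends the
   norm bound, and boundedness extends the equality of inner products from rank one operators. *)

theory Submission
  imports Defs
begin

section \<open>Complex inner products\<close>

text \<open>Everything rests on pointwise control: \<open>dequantize\<close> yields genuine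
  functions bounded by \<open>hs_norm T * hs_norm A\<close>, so replacing T and A by finite rank
  operators gives convergence at every point. This supplies measurability and makes Fatou
  applicable. Fatou loses equality, which is why a second passage is needed, by functionals that
  agree on rank one operators; for these the integral over G x G factors into two orthogonality
  relations. \<open>cadjoint\<close> and \<open>quantize\<close> are definite descriptions and
  \<open>trace_op\<close> sums over one chosen basis, so existence, uniqueness and basis
  independence precede every formula. The operator representing an antilinear functional F is read
  off from the numbers F(|x><y|) by Riesz in the underlying space, which takes the place of
  completeness of the Hilbert-Schmidt space. The integrals are iterated because each one is, by
  itself, a pairing of two square integrable functions; nothing is claimed about the joint
  integrand. The condition \<open>hs_norm T = 1\<close> turns the statement on functions into the
  one on operators.\<close>

lemmas cinner_simps = cinner_add_right cinner_scaleC_right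

lemma cinner_add_left: "cinner (x + y) z = cinner x z + cinner y (z::'a::complex_inner)"
  by (metis cinner_add_right cinner_commute complex_cnj_add)

lemma cinner_scaleC_left: "cinner (c *\<^sub>C x) y = cnj c * cinner x (y::'a::complex_inner)"
  by (metis cinner_commute cinner_scaleC_right complex_cnj_mult)

lemma cinner_zero_right [simp]: "cinner x (0::'a::complex_inner) = 0"
  using cinner_add_right[of x 0 0] by simp

lemma cinner_zero_left [simp]: "cinner (0::'a::complex_inner) x = 0"
  using cinner_add_left[of 0 0 x] by simp

lemma cinner_minus_right: "cinner x (- y) = - cinner x (y::'a::complex_inner)"
  using cinner_add_right[of x y "- y"] by (simp add: eq_neg_iff_add_eq_0 add.commute)

lemma cinner_minus_left: "cinner (- x) y = - cinner x (y::'a::complex_inner)"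
  using cinner_add_left[of x "- x" y] by (simp add: eq_neg_iff_add_eq_0 add.commute)

lemma cinner_diff_right: "cinner x (y - z) = cinner x y - cinner x (z::'a::complex_inner)"
  using cinner_add_right[of x y "- z"] by (simp add: cinner_minus_right)

lemma cinner_diff_left: "cinner (x - y) z = cinner x z - cinner y (z::'a::complex_inner)"
  using cinner_add_left[of x "- y" z] by (simp add: cinner_minus_left)

lemma cinner_sum_right: "cinner x (\<Sum>i\<in>I. f i) = (\<Sum>i\<in>I. cinner x (f i :: 'a::complex_inner))"
  by (induction I rule: infinite_finite_induct) (simp_all add: cinner_add_right)

lemma cinner_sum_left: "cinner (\<Sum>i\<in>I. f i) x = (\<Sum>i\<in>I. cinner (f i :: 'a::complex_inner) x)"
  by (induction I rule: infinite_finite_induct) (simp_all add: cinner_add_left)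

lemma cinner_self: "cinner x x = complex_of_real ((norm (x::'a::complex_inner))\<^sup>2)"
proof -
  have "Im (cinner x x) = 0"
    using arg_cong[OF cinner_commute[of x x], of Im] by simp
  moreover have "Re (cinner x x) = (norm x)\<^sup>2"
    by (simp add: inner_eq_Re_cinner[symmetric] power2_norm_eq_inner)
  ultimately show ?thesis by (simp add: complex_eq_iff)
qed

lemma cinner_self_eq_0: "cinner x x = 0 \<longleftrightarrow> x = (0::'a::complex_inner)"
  by (simp add: cinner_self)

lemma scaleC_zero_left [simp]: "0 *\<^sub>C (x::'a::complex_inner) = 0"
  using scaleC_add_left[of 0 0 x] by simp

lemma scaleC_one [simp]: "1 *\<^sub>C (x::'a::complex_inner) = x"
  using scaleC_of_real[of 1 x] by simp

lemma norm_scaleC [simp]: "norm (c *\<^sub>C x) = cmod c * norm (x::'a::complex_inner)"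
proof -
  have "complex_of_real ((norm (c *\<^sub>C x))\<^sup>2) = complex_of_real ((cmod c * norm x)\<^sup>2)"
    unfolding cinner_self[symmetric] cinner_scaleC_left cinner_scaleC_right
    by (simp add: cinner_self power_mult_distrib complex_mult_cnj cmod_power2 mult.assoc[symmetric]
        mult.commute[of "cnj c"])
  then have "(norm (c *\<^sub>C x))\<^sup>2 = (cmod c * norm x)\<^sup>2"
    using of_real_eq_iff by blast
  then show ?thesis
    by (simp add: power2_eq_iff_nonneg)
qed

lemma cmod_cinner_le: "cmod (cinner x y) \<le> norm x * norm (y::'a::complex_inner)"
proof (cases "cinner x y = 0")
  case False
  \<comment> \<open>u is the phase that turns \<open>cinner x y\<close> into its modulus, so that
    the real Cauchy-Schwarz inequality bounds the complex product.\<close>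
  define u where "u = cnj (cinner x y) / complex_of_real (cmod (cinner x y))"
  have u: "cmod u = 1" using False by (simp add: u_def norm_divide)
  have "cinner x (u *\<^sub>C y) = complex_of_real (cmod (cinner x y))"
    using False complex_norm_square[of "cinner x y"] unfolding u_def cinner_scaleC_right
    by (simp add: field_simps power2_eq_square)
  then have "cmod (cinner x y) = inner x (u *\<^sub>C y)"
    by (simp add: inner_eq_Re_cinner)
  also have "\<dots> \<le> norm x * norm (u *\<^sub>C y)" by (rule norm_cauchy_schwarz)
  finally show ?thesis by (simp add: u)
qed simp

lemma cinner_eq_all_imp_eq:
  assumes "\<And>x. cinner x y = cinner x (z::'a::complex_inner)"
  shows "y = z"
  using assms[of "y - z"] cinner_self_eq_0[of "y - z"] by (simp add: cinner_diff_right)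

section \<open>The Riesz representation theorem and adjoints\<close>

text \<open>The representing vector is the minimiser of \<open>norm x ^ 2 - 2 * f x\<close>; by the parallelogram law
  minimising sequences are Cauchy.\<close>

lemma riesz_real:
  fixes f :: "'a::{real_inner,complete_space} \<Rightarrow> real"
  assumes f: "linear f" and K: "\<And>x. \<bar>f x\<bar> \<le> K * norm x"
  shows "\<exists>z. \<forall>x. f x = inner z x"
proof -
  define J where "J x = inner x x - 2 * f x" for x
  have add: "f (x + y) = f x + f y" and scale: "f (c *\<^sub>R x) = c * f x" for x y c
    using f by (simp_all add: linear_add linear_cmul)
  \<comment> \<open>Completing the square in \<open>norm x\<close>. The lower bound is what makes
    the infimum m meaningful.\<close>
  have bnd: "J x \<ge> - K\<^sup>2" for x
  proof -
    have "J x \<ge> (norm x)\<^sup>2 - 2 * (K * norm x)"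
      using K[of x] by (simp add: J_def power2_norm_eq_inner)
    moreover have "(norm x)\<^sup>2 - 2 * (K * norm x) + K\<^sup>2 = (norm x - K)\<^sup>2"
      by (simp add: power2_eq_square algebra_simps)
    ultimately show ?thesis using zero_le_power2[of "norm x - K"] by linarith
  qed
  define m where "m = (INF x. J x)"
  have bdd: "bdd_below (range J)" using bnd by (auto simp: bdd_below_def)
  have m_le: "m \<le> J x" for x unfolding m_def by (rule cINF_lower[OF bdd]) simp
  have "\<exists>x. J x < m + 1 / real (Suc n)" for n
    using cINF_less_iff[OF _ bdd, of "m + 1 / real (Suc n)"] by (auto simp: m_def[symmetric])
  then obtain X where X: "\<And>n. J (X n) < m + 1 / real (Suc n)" by metis
  have par: "(norm (x - y))\<^sup>2 \<le> 2 * J x + 2 * J y - 4 * m" for x y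
  proof -
    define w where "w = (1/2) *\<^sub>R (x + y)"
    have "inner w w = (inner x x + 2 * inner x y + inner y y) / 4"
      by (simp add: w_def inner_simps inner_commute)
    moreover have "f w = (f x + f y) / 2" by (simp add: w_def scale add)
    moreover have "(norm (x - y))\<^sup>2 = inner x x - 2 * inner x y + inner y y"
      by (simp add: power2_norm_eq_inner inner_simps inner_commute)
    ultimately have "J x + J y = 2 * J w + (norm (x - y))\<^sup>2 / 2"
      unfolding J_def by (simp add: field_simps)
    then show ?thesis using m_le[of w] by linarith
  qed
  have "Cauchy X"
    unfolding Cauchy_altdef2
  proof (intro allI impI)
    fix e :: real assume e: "e > 0"
    \<comment> \<open>For n >= N both values of J exceed m by less than 1 / Suc N, so
      \<open>par\<close> bounds the squared distance by 4 / Suc N.\<close>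
    obtain N where N: "1 / real (Suc N) < e\<^sup>2 / 4"
      using e by (metis nat_approx_posE zero_less_divide_iff zero_less_numeral zero_less_power)
    have "dist (X n) (X N) < e" if "n \<ge> N" for n
    proof -
      have "1 / real (Suc n) \<le> 1 / real (Suc N)"
        using that by (intro divide_left_mono) auto
      then have "(norm (X n - X N))\<^sup>2 < e\<^sup>2"
        using par[of "X n" "X N"] X[of n] X[of N] N by linarith
      then show ?thesis using e by (simp add: dist_norm power2_less_imp_less)
    qed
    then show "\<exists>N. \<forall>n\<ge>N. dist (X n) (X N) < e" by blast
  qed
  then obtain z where z: "X \<longlonglongrightarrow> z"
    using Cauchy_convergent convergent_def by blast
  have "bounded_linear f"
    by (rule bounded_linear_intro[where K=K]) (use add scale K in \<open>auto simp: mult.commute\<close>)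
  from bounded_linear.tendsto[OF this z] have "(\<lambda>n. J (X n)) \<longlonglongrightarrow> J z"
    unfolding J_def by (intro tendsto_diff tendsto_inner tendsto_mult_left z)
  moreover have "(\<lambda>n. m + 1 / real (Suc n)) \<longlonglongrightarrow> m + 0"
    by (rule tendsto_add[OF tendsto_const LIMSEQ_Suc[OF lim_1_over_n]])
  ultimately have Jz: "J z \<le> m"
    using X by (intro LIMSEQ_le[where X="\<lambda>n. J (X n)"]) (auto intro: less_imp_le)
  have "f x = inner z x" for x
  proof (rule ccontr)
    define d where "d = inner z x - f x"
    assume "f x \<noteq> inner z x"
    then have d: "d \<noteq> 0" by (simp add: d_def)
    have x: "inner x x > 0" using d by (auto simp: d_def f linear_0)
    have J: "J (z + t *\<^sub>R x) = J z + 2 * t * d + t\<^sup>2 * inner x x" for t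
      unfolding J_def add scale d_def
      by (simp add: inner_simps inner_commute power2_eq_square algebra_simps)
    \<comment> \<open>t = - d / inner x x minimises the quadratic polynomial in t; a nonzero d would
      push J below its infimum.\<close>
    have "J (z + (- d / inner x x) *\<^sub>R x) = J z - d\<^sup>2 / inner x x"
      unfolding J using x by (simp add: field_simps power2_eq_square)
    moreover have "d\<^sup>2 / inner x x > 0" using d x by simp
    ultimately show False using m_le[of "z + (- d / inner x x) *\<^sub>R x"] Jz by linarith
  qed
  then show ?thesis by blast
qed

text \<open>The real version applied to Re f is enough, because f(i x) = i f(x) recovers the
  imaginary part from real parts.\<close>

lemma riesz:
  fixes f :: "'h::complex_hilbert \<Rightarrow> complex"
  assumes add: "\<And>x y. f (x + y) = f x + f y"
    and scale: "\<And>c x. f (c *\<^sub>C x) = c * f x"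
    and K: "\<And>x. cmod (f x) \<le> K * norm x"
  shows "\<exists>z. \<forall>x. f x = cinner z x"
proof -
  have "linear (\<lambda>x. Re (f x))"
    by (rule linearI) (simp_all add: add scale scaleC_of_real[symmetric])
  moreover have "\<bar>Re (f x)\<bar> \<le> K * norm x" for x
    using abs_Re_le_cmod[of "f x"] K[of x] by linarith
  ultimately obtain z where z: "\<And>x. Re (f x) = inner z x" using riesz_real by blast
  then have "Re (f x) = Re (cinner z x)" for x by (simp add: inner_eq_Re_cinner)
  from this this[of "\<i> *\<^sub>C _"] show ?thesis
    by (intro exI[of _ z]) (simp add: complex_eq_iff scale cinner_scaleC_right)
qed

section \<open>Bounded operators and their adjoints\<close>

lemma bounded_clinear_add: "bounded_clinear A \<Longrightarrow> A (x + y) = A x + A y"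
  and bounded_clinear_scaleC: "bounded_clinear A \<Longrightarrow> A (c *\<^sub>C x) = c *\<^sub>C A x"
  by (simp_all add: bounded_clinear_def clinear_def)

lemma bounded_clinear_bound:
  assumes "bounded_clinear A" obtains K where "K \<ge> 0" "\<And>x. norm (A x) \<le> K * norm x"
proof -
  obtain K where K: "\<And>x. norm (A x) \<le> K * norm x"
    using assms by (auto simp: bounded_clinear_def)
  have "norm (A x) \<le> max K 0 * norm x" for x
    using K[of x] by (meson max.cobounded1 mult_right_mono norm_ge_zero order_trans)
  then show thesis using that[of "max K 0"] by simp
qed

lemma bounded_clinearI:
  assumes "\<And>x y. A (x + y) = A x + A y" "\<And>c x. A (c *\<^sub>C x) = c *\<^sub>C A x"
    "\<And>x. norm (A x) \<le> K * norm x"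
  shows "bounded_clinear A"
  using assms by (auto simp: bounded_clinear_def clinear_def)

lemma ex_adjoint:
  fixes A :: "'h::complex_hilbert \<Rightarrow> 'h"
  assumes A: "bounded_clinear A"
  shows "\<exists>A'. \<forall>x y. cinner (A' x) y = cinner x (A y)"
proof -
  obtain K where K: "\<And>x. norm (A x) \<le> K * norm x" using bounded_clinear_bound[OF A] by metis
  have "\<exists>z. \<forall>y. cinner x (A y) = cinner z y" for x
  proof (rule riesz)
    show "cmod (cinner x (A y)) \<le> (norm x * K) * norm y" for y
      using cmod_cinner_le[of x "A y"] mult_left_mono[OF K[of y], of "norm x"] by (simp add: mult.assoc)
  qed (simp_all add: bounded_clinear_add[OF A] bounded_clinear_scaleC[OF A] cinner_simps)
  then show ?thesis by metis
qed

text \<open>Uniqueness in the definite description is nondegeneracy of \<open>cinner\<close>, so any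
  candidate with the defining relation is the adjoint. Explicit adjoints are computed by this
  rule.\<close>

lemma cadjoint_eqI:
  assumes "\<And>x y. cinner (A' x) y = cinner x (A y)"
  shows "cadjoint A = A'"
  unfolding cadjoint_def
proof (rule the_equality)
  fix B assume B: "\<forall>x y. cinner (B x) y = cinner x (A y)"
  show "B = A'"
  proof
    fix x
    have "cinner y (B x) = cinner y (A' x)" for y
      using B assms by (metis cinner_commute)
    then show "B x = A' x" by (rule cinner_eq_all_imp_eq)
  qed
qed (use assms in blast)

lemma cinner_cadjoint_left:
  assumes "bounded_clinear A" shows "cinner (cadjoint A x) y = cinner x (A y)"
  using ex_adjoint[OF assms] cadjoint_eqI by metis

lemma cinner_cadjoint_right:
  assumes "bounded_clinear A" shows "cinner x (cadjoint A y) = cinner (A x) y"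
  using cinner_cadjoint_left[OF assms] by (metis cinner_commute)

lemma cadjoint_cadjoint: "bounded_clinear A \<Longrightarrow> cadjoint (cadjoint A) = A"
  by (intro cadjoint_eqI) (simp add: cinner_cadjoint_right)

lemma bounded_clinear_cadjoint:
  fixes A :: "'h::complex_hilbert \<Rightarrow> 'h"
  assumes A: "bounded_clinear A"
  shows "bounded_clinear (cadjoint A)"
proof -
  obtain K where K: "\<And>x. norm (A x) \<le> K * norm x" using bounded_clinear_bound[OF A] by metis
  show ?thesis
  proof (rule bounded_clinearI[where K=K])
    show "cadjoint A (x + y) = cadjoint A x + cadjoint A y" for x y
      by (rule cinner_eq_all_imp_eq) (simp add: cinner_cadjoint_right[OF A] cinner_simps)
    show "cadjoint A (c *\<^sub>C x) = c *\<^sub>C cadjoint A x" for c x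
      by (rule cinner_eq_all_imp_eq) (simp add: cinner_cadjoint_right[OF A] cinner_simps)
    fix x
    let ?y = "cadjoint A x"
    have "(norm ?y)\<^sup>2 = cmod (cinner (A ?y) x)"
      by (simp add: cinner_cadjoint_right[OF A, symmetric] cinner_self norm_power)
    also have "\<dots> \<le> K * norm ?y * norm x"
      using cmod_cinner_le[of "A ?y" x] mult_right_mono[OF K[of ?y], of "norm x"] by simp
    finally show "norm ?y \<le> K * norm x"
      \<comment> \<open>Cancelling \<open>norm ?y\<close> leaves the claim. If it vanishes,
        \<open>K * norm x\<close> is still nonnegative because it dominates
        \<open>norm (A x)\<close>.\<close>
      using K[of x] order_trans[OF norm_ge_zero K[of x]]
      by (cases "norm ?y = 0") (auto simp: power2_eq_square mult_ac)
  qed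
qed

lemma bounded_clinear_compose:
  assumes A: "bounded_clinear A" and B: "bounded_clinear B"
  shows "bounded_clinear (A \<circ> B)"
proof -
  obtain K where K: "K \<ge> 0" "\<And>x. norm (A x) \<le> K * norm x" using bounded_clinear_bound[OF A] by metis
  obtain L where L: "\<And>x. norm (B x) \<le> L * norm x" using bounded_clinear_bound[OF B] by metis
  have "norm (A (B x)) \<le> (K * L) * norm x" for x
    using K(2)[of "B x"] mult_left_mono[OF L[of x] K(1)] by (simp add: mult.assoc)
  then show ?thesis
    by (intro bounded_clinearI)
      (auto simp: bounded_clinear_add[OF A] bounded_clinear_add[OF B]
        bounded_clinear_scaleC[OF A] bounded_clinear_scaleC[OF B])
qed

lemma cadjoint_compose:
  assumes "bounded_clinear A" "bounded_clinear B"
  shows "cadjoint (A \<circ> B) = cadjoint B \<circ> cadjoint A"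
  by (rule cadjoint_eqI) (simp add: cinner_cadjoint_left assms)

lemma unitary_norm: "unitary_op A \<Longrightarrow> norm (A x) = norm x"
proof -
  assume "unitary_op A"
  then have "complex_of_real ((norm (A x))\<^sup>2) = complex_of_real ((norm x)\<^sup>2)"
    unfolding cinner_self[symmetric] by (simp add: unitary_op_def)
  then show ?thesis using of_real_eq_iff power2_eq_iff_nonneg norm_ge_zero by blast
qed

lemma unitary_bounded_clinear: "unitary_op A \<Longrightarrow> bounded_clinear A"
  using unitary_norm[of A] by (auto simp: unitary_op_def bounded_clinear_def intro!: exI[of _ 1])

section \<open>Orthonormal bases\<close>

lemma bessel:
  fixes x :: "'h::complex_hilbert"
  assumes "orthonormal_basis B" "finite F" "F \<subseteq> B"
  shows "(\<Sum>e\<in>F. (cmod (cinner e x))\<^sup>2) \<le> (norm x)\<^sup>2"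
proof -
  \<comment> \<open>p is the orthogonal projection of x onto the span of F; the inequality is
    nonnegativity of the squared norm of x - p.\<close>
  define p where "p = (\<Sum>e\<in>F. cinner e x *\<^sub>C e)"
  have on: "cinner e f = (if e = f then 1 else 0)" if "e \<in> F" "f \<in> F" for e f
    using assms that unfolding orthonormal_basis_def by (metis subsetD)
  have px: "cinner p x = complex_of_real (\<Sum>e\<in>F. (cmod (cinner e x))\<^sup>2)"
    unfolding p_def cinner_sum_left cinner_scaleC_left of_real_sum complex_norm_square
    by (simp add: mult.commute)
  have "cinner e p = cinner e x" if "e \<in> F" for e
    using that assms(2) unfolding p_def cinner_sum_right cinner_scaleC_right
    by (simp add: on if_distrib cong: if_cong)
  then have pp: "cinner p p = cinner p x"
    unfolding px by (subst (1) p_def)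
      (simp add: cinner_sum_left cinner_scaleC_left complex_norm_square mult.commute
        del: of_real_power)
  have "cinner (x - p) (x - p) = cinner x x - cinner x p"
    by (simp add: cinner_diff_left cinner_diff_right pp)
  moreover have "cinner x p = cinner p x"
    using px cinner_commute[of x p] by simp
  ultimately have "complex_of_real ((norm (x - p))\<^sup>2) =
      complex_of_real ((norm x)\<^sup>2 - (\<Sum>e\<in>F. (cmod (cinner e x))\<^sup>2))"
    unfolding cinner_self[symmetric] by (simp add: px cinner_self)
  then have "(norm (x - p))\<^sup>2 = (norm x)\<^sup>2 - (\<Sum>e\<in>F. (cmod (cinner e x))\<^sup>2)"
    using of_real_eq_iff by blast
  then show ?thesis using zero_le_power2[of "norm (x - p)"] by linarith
qed

lemma parseval:
  fixes x y :: "'h::complex_hilbert"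
  assumes B: "orthonormal_basis B"
  shows "((\<lambda>e. cinner x e * cinner e y) has_sum cinner x y) B"
proof -
  \<comment> \<open>Cauchy-Schwarz over F combined with Bessel. This one bound gives both absolute
    summability and continuity of the functional f below.\<close>
  have finite_bound: "(\<Sum>e\<in>F. cmod (cinner x e * cinner e y)) \<le> norm x * norm y"
    if "finite F" "F \<subseteq> B" for F x y
  proof -
    have "(\<Sum>e\<in>F. cmod (cinner x e * cinner e y)) =
        (\<Sum>e\<in>F. \<bar>cmod (cinner e x)\<bar> * \<bar>cmod (cinner e y)\<bar>)"
      by (simp add: norm_mult) (metis cinner_commute complex_mod_cnj)
    also have "\<dots> \<le> L2_set (\<lambda>e. cmod (cinner e x)) F * L2_set (\<lambda>e. cmod (cinner e y)) F"
      by (rule L2_set_mult_ineq)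
    also have "\<dots> \<le> norm x * norm y"
      unfolding L2_set_def
      by (intro mult_mono real_le_lsqrt bessel[OF B that]) (auto intro: sum_nonneg)
    finally show ?thesis .
  qed
  have abs: "(\<lambda>e. cmod (cinner x e * cinner e y)) summable_on B" for x y
    using finite_bound[of _ x y]
    by (intro nonneg_bdd_above_summable_on) (auto simp: bdd_above_def intro!: exI[of _ "norm x * norm y"])
  \<comment> \<open>By Riesz the bounded functional \<open>f\<close> is \<open>cinner z\<close>, and \<open>z = x\<close> because both have the same coefficients.
    No convergence of the expansion of \<open>x\<close> in norm is needed.\<close>
  define f where "f y = (\<Sum>\<^sub>\<infinity>e\<in>B. cinner x e * cinner e y)" for y
  have has: "((\<lambda>e. cinner x e * cinner e y) has_sum f y) B" for y
    unfolding f_def by (rule has_sum_infsum[OF Infinite_Sum.abs_summable_summable[OF abs]])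
  have "\<exists>z. \<forall>y. f y = cinner z y"
  proof (rule riesz)
    show "f (y + z) = f y + f z" for y z
      using has_sum_add[OF has[of y] has[of z]] has[of "y + z"]
      by (simp add: cinner_simps distrib_left has_sum_unique)
    show "f (c *\<^sub>C y) = c * f y" for c y
      using has_sum_cmult_right[OF has[of y], of c] has[of "c *\<^sub>C y"]
      by (simp add: cinner_simps mult_ac has_sum_unique)
    show "cmod (f y) \<le> norm x * norm y" for y
    proof -
      have "cmod (f y) \<le> (\<Sum>\<^sub>\<infinity>e\<in>B. cmod (cinner x e * cinner e y))"
        unfolding f_def by (rule norm_infsum_bound[OF abs])
      also have "\<dots> \<le> norm x * norm y"
        by (rule infsum_le_finite_sums[OF abs]) (use finite_bound in blast)
      finally show ?thesis .
    qed
  qed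
  then obtain z where z: "\<And>y. f y = cinner z y" by blast
  have "cinner e (z - x) = 0" if e: "e \<in> B" for e
  proof -
    have "cinner x b * cinner b e = (if b = e then cinner x e else 0)" if "b \<in> B" for b
      using B e that by (auto simp: orthonormal_basis_def)
    then have "((\<lambda>b. if b = e then cinner x e else 0) has_sum f e) B"
      using has[of e] by (simp cong: has_sum_cong)
    moreover have "((\<lambda>b. if b = e then cinner x e else 0) has_sum cinner x e) B"
      by (rule has_sum_finite_neutralI[where B="{e}"]) (use e in auto)
    ultimately have "cinner z e = cinner x e"
      using has_sum_unique z by metis
    then have "cinner e z = cinner e x" by (metis cinner_commute)
    then show ?thesis by (simp add: cinner_diff_right)
  qed
  then have "z - x = 0"
    using B by (auto simp: orthonormal_basis_def simp del: right_minus_eq)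
  then have "z = x" by simp
  then show ?thesis using has[of y] z by simp
qed

lemma parseval_norm:
  fixes x :: "'h::complex_hilbert"
  assumes B: "orthonormal_basis B"
  shows "((\<lambda>e. (cmod (cinner e x))\<^sup>2) has_sum (norm x)\<^sup>2) B"
proof -
  have "cinner x e * cinner e x = complex_of_real ((cmod (cinner e x))\<^sup>2)" for e
    by (metis cinner_commute complex_norm_square mult.commute of_real_power)
  then show ?thesis
    using parseval[OF B, of x x] by (simp only: cinner_self has_sum_of_real_iff)
qed

section \<open>Hilbert-Schmidt operators\<close>

text \<open>The basis inside \<open>trace_op\<close>. That a basis exists is part of
  \<open>hilbert_schmidt\<close>, so the choice is meaningful as soon as one Hilbert-Schmidt
  operator is given.\<close>

definition some_onb :: "'h::complex_hilbert set"
  where "some_onb = (SOME B. orthonormal_basis B)"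

lemma orthonormal_basis_some_onb:
  "orthonormal_basis (B :: 'h::complex_hilbert set) \<Longrightarrow> orthonormal_basis (some_onb :: 'h set)"
  unfolding some_onb_def by (rule someI)

text \<open>Both series are the double sum of the squared matrix entries
  \<open>cmod (cinner f (A e))\<close>, summed by Parseval along rows and along columns; nonnegative
  terms may be exchanged. Two different bases are allowed so that a second application, to the
  adjoint, changes the basis for A itself.\<close>

lemma has_sum_norm_cadjoint:
  fixes A :: "'h::complex_hilbert \<Rightarrow> 'h"
  assumes A: "bounded_clinear A" and B: "orthonormal_basis B" and C: "orthonormal_basis C"
    and s: "((\<lambda>e. (norm (A e))\<^sup>2) has_sum s) B"
  shows "((\<lambda>f. (norm (cadjoint A f))\<^sup>2) has_sum s) C"
proof -
  define p where "p = (\<lambda>(e, f). (cmod (cinner f (A e)))\<^sup>2)"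
  have row: "((\<lambda>f. p (e, f)) has_sum (norm (A e))\<^sup>2) C" for e
    unfolding p_def using parseval_norm[OF C] by simp
  have "p summable_on (B \<times> C)"
    by (rule summable_on_SigmaI[OF row])
      (use s in \<open>auto simp: p_def summable_on_def\<close>)
  then have "(p has_sum s) (B \<times> C)"
    by (rule has_sum_SigmaI[OF row s])
  then have swapped: "((\<lambda>(f, e). p (e, f)) has_sum s) (C \<times> B)"
    by (rule has_sum_swap[THEN iffD1])
  have "((\<lambda>e. case (f, e) of (f, e) \<Rightarrow> p (e, f)) has_sum (norm (cadjoint A f))\<^sup>2) B" for f
  proof -
    have "cmod (cinner f (A e)) = cmod (cinner e (cadjoint A f))" for e
      by (metis cinner_cadjoint_right[OF A] cinner_commute complex_mod_cnj)
    then show ?thesis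
      unfolding p_def using parseval_norm[OF B] by simp
  qed
  then show ?thesis by (rule has_sum_SigmaD[OF swapped])
qed

lemma hilbert_schmidt_bounded: "hilbert_schmidt A \<Longrightarrow> bounded_clinear A"
  by (simp add: hilbert_schmidt_def)

lemma hilbert_schmidt_onb:
  "hilbert_schmidt (A :: 'h \<Rightarrow> 'h::complex_hilbert) \<Longrightarrow> orthonormal_basis (some_onb :: 'h set)"
  by (auto simp: hilbert_schmidt_def intro: orthonormal_basis_some_onb)

lemma hilbert_schmidtI:
  assumes "bounded_clinear A" "orthonormal_basis B" "((\<lambda>e. (norm (A e))\<^sup>2) has_sum s) B"
  shows "hilbert_schmidt A"
  using assms by (auto simp: hilbert_schmidt_def summable_on_def)

lemma hilbert_schmidt_cadjoint:
  assumes "hilbert_schmidt A" shows "hilbert_schmidt (cadjoint A)"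
proof -
  obtain B s where B: "orthonormal_basis B" and s: "((\<lambda>e. (norm (A e))\<^sup>2) has_sum s) B"
    and A: "bounded_clinear A"
    using assms by (auto simp: hilbert_schmidt_def summable_on_def)
  show ?thesis
    by (rule hilbert_schmidtI[OF bounded_clinear_cadjoint[OF A] B has_sum_norm_cadjoint[OF A B B s]])
qed

text \<open>The basis hidden in the definition is exchanged for C through the adjoint on C, followed
  by the double adjoint.\<close>

lemma hilbert_schmidt_summable:
  assumes A: "hilbert_schmidt A" and C: "orthonormal_basis C"
  shows "(\<lambda>e. (norm (A e))\<^sup>2) summable_on C"
proof -
  obtain B s where B: "orthonormal_basis B" and s: "((\<lambda>e. (norm (A e))\<^sup>2) has_sum s) B"
    and bd: "bounded_clinear A"
    using A by (auto simp: hilbert_schmidt_def summable_on_def)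
  from has_sum_norm_cadjoint[OF bounded_clinear_cadjoint[OF bd] C C has_sum_norm_cadjoint[OF bd B C s]]
  show ?thesis using cadjoint_cadjoint[OF bd] by (auto simp: summable_on_def)
qed

lemma hilbert_schmidt_abs_summable:
  assumes "hilbert_schmidt A" "hilbert_schmidt B" "orthonormal_basis C"
  shows "(\<lambda>e. cmod (cinner (A e) (B e))) summable_on C"
proof (rule summable_on_comparison_test)
  show "(\<lambda>e. (norm (A e))\<^sup>2 + (norm (B e))\<^sup>2) summable_on C"
    by (intro summable_on_add hilbert_schmidt_summable assms)
  fix e
  have "cmod (cinner (A e) (B e)) \<le> norm (A e) * norm (B e)" by (rule cmod_cinner_le)
  also have "\<dots> \<le> (norm (A e))\<^sup>2 + (norm (B e))\<^sup>2"
  proof -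
    have "2 * (norm (A e) * norm (B e)) \<le> (norm (A e))\<^sup>2 + (norm (B e))\<^sup>2"
      "0 \<le> norm (A e) * norm (B e)"
      using sum_squares_bound[of "norm (A e)" "norm (B e)"] by (simp_all add: mult.assoc)
    then show ?thesis by linarith
  qed
  finally show "cmod (cinner (A e) (B e)) \<le> (norm (A e))\<^sup>2 + (norm (B e))\<^sup>2" .
qed simp

text \<open>\<open>infsum\<close> is 0 on families that are not summable, so convergence must
  accompany the value; afterwards identities for \<open>hs_inner\<close> follow from uniqueness of
  sums.\<close>

lemma hs_inner_has_sum:
  assumes A: "hilbert_schmidt A" and B: "hilbert_schmidt B"
  shows "((\<lambda>e. cinner (A e) (B e)) has_sum hs_inner A B) some_onb"
proof -
  have "hs_inner A B = (\<Sum>\<^sub>\<infinity>e\<in>some_onb. cinner (A e) (B e))"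
    unfolding hs_inner_def trace_op_def some_onb_def
    by (simp add: cinner_cadjoint_right[OF hilbert_schmidt_bounded[OF A]])
  then show ?thesis
    using has_sum_infsum[OF Infinite_Sum.abs_summable_summable[OF
          hilbert_schmidt_abs_summable[OF A B hilbert_schmidt_onb[OF A]]]] by simp
qed

lemma
  assumes A: "hilbert_schmidt A"
  shows hs_inner_self: "hs_inner A A = complex_of_real ((hs_norm A)\<^sup>2)"
    and hs_norm_some: "((\<lambda>e. (norm (A e))\<^sup>2) has_sum (hs_norm A)\<^sup>2) some_onb"
    and hs_norm_nonneg: "hs_norm A \<ge> 0"
proof -
  obtain s where s: "((\<lambda>e. (norm (A e))\<^sup>2) has_sum s) some_onb"
    using hilbert_schmidt_summable[OF A hilbert_schmidt_onb[OF A]] by (auto simp: summable_on_def)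
  have "((\<lambda>e. cinner (A e) (A e)) has_sum complex_of_real s) some_onb"
    using s by (simp only: cinner_self has_sum_of_real_iff)
  then have i: "hs_inner A A = complex_of_real s"
    by (rule has_sum_unique[OF hs_inner_has_sum[OF A A]])
  moreover have s0: "s \<ge> 0" using s by (rule has_sum_nonneg) simp
  ultimately have "(hs_norm A)\<^sup>2 = s" by (simp add: hs_norm_def)
  then show "hs_inner A A = complex_of_real ((hs_norm A)\<^sup>2)"
    "((\<lambda>e. (norm (A e))\<^sup>2) has_sum (hs_norm A)\<^sup>2) some_onb"
    using s i by simp_all
  show "hs_norm A \<ge> 0" using s0 by (simp add: hs_norm_def i)
qed

lemma hs_norm_has_sum_cadjoint:
  assumes A: "hilbert_schmidt A" and C: "orthonormal_basis C"
  shows "((\<lambda>e. (norm (cadjoint A e))\<^sup>2) has_sum (hs_norm A)\<^sup>2) C"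
  by (rule has_sum_norm_cadjoint[OF hilbert_schmidt_bounded[OF A] hilbert_schmidt_onb[OF A] C
        hs_norm_some[OF A]])

lemma hs_norm_cadjoint:
  assumes A: "hilbert_schmidt A" shows "hs_norm (cadjoint A) = hs_norm A"
proof -
  have "(hs_norm (cadjoint A))\<^sup>2 = (hs_norm A)\<^sup>2"
    by (rule has_sum_unique[OF hs_norm_some[OF hilbert_schmidt_cadjoint[OF A]]
          hs_norm_has_sum_cadjoint[OF A hilbert_schmidt_onb[OF A]]])
  then show ?thesis
    by (rule power2_eq_imp_eq) (intro hs_norm_nonneg hilbert_schmidt_cadjoint A)+
qed

lemma hs_norm_has_sum:
  assumes A: "hilbert_schmidt A" and C: "orthonormal_basis C"
  shows "((\<lambda>e. (norm (A e))\<^sup>2) has_sum (hs_norm A)\<^sup>2) C"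
  using hs_norm_has_sum_cadjoint[OF hilbert_schmidt_cadjoint[OF A] C]
  by (simp add: hs_norm_cadjoint A cadjoint_cadjoint hilbert_schmidt_bounded)

section \<open>Sums, multiples and products with bounded operators\<close>

lemma bounded_clinear_plus:
  assumes "bounded_clinear A" "bounded_clinear B" shows "bounded_clinear (\<lambda>x. A x + B x)"
proof -
  obtain K where K: "\<And>x. norm (A x) \<le> K * norm x" using bounded_clinear_bound[OF assms(1)] by metis
  obtain L where L: "\<And>x. norm (B x) \<le> L * norm x" using bounded_clinear_bound[OF assms(2)] by metis
  show ?thesis
  proof (rule bounded_clinearI[where K="K + L"])
    show "norm (A x + B x) \<le> (K + L) * norm x" for x
      using norm_triangle_ineq[of "A x" "B x"] K[of x] L[of x] by (simp add: distrib_right)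
  qed (simp_all add: bounded_clinear_add assms bounded_clinear_scaleC scaleC_add_right)
qed

lemma scaleC_commute: "a *\<^sub>C b *\<^sub>C (x::'a::complex_inner) = b *\<^sub>C a *\<^sub>C x"
  by (simp add: scaleC_scaleC mult.commute)

lemma bounded_clinear_scale:
  assumes "bounded_clinear A" shows "bounded_clinear (\<lambda>x. c *\<^sub>C A x)"
proof -
  obtain K where K: "\<And>x. norm (A x) \<le> K * norm x" using bounded_clinear_bound[OF assms(1)] by metis
  show ?thesis
  proof (rule bounded_clinearI[where K="cmod c * K"])
    show "norm (c *\<^sub>C A x) \<le> cmod c * K * norm x" for x
      using mult_left_mono[OF K[of x], of "cmod c"] by (simp add: mult.assoc)
  qed (auto simp: bounded_clinear_add assms bounded_clinear_scaleC scaleC_add_right intro: scaleC_commute)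
qed

lemma hilbert_schmidt_plus:
  fixes A :: "'h::complex_hilbert \<Rightarrow> 'h"
  assumes A: "hilbert_schmidt A" and B: "hilbert_schmidt B"
  shows "hilbert_schmidt (\<lambda>x. A x + B x)"
  unfolding hilbert_schmidt_def
proof (intro conjI exI)
  show "bounded_clinear (\<lambda>x. A x + B x)"
    by (intro bounded_clinear_plus hilbert_schmidt_bounded A B)
  show C: "orthonormal_basis (some_onb :: 'h set)" by (rule hilbert_schmidt_onb[OF A])
  show "(\<lambda>e. (norm (A e + B e))\<^sup>2) summable_on some_onb"
  proof (rule summable_on_comparison_test)
    show "(\<lambda>e. 2 * ((norm (A e))\<^sup>2 + (norm (B e))\<^sup>2)) summable_on some_onb"
      by (intro summable_on_cmult_right summable_on_add hilbert_schmidt_summable A B C)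
    fix e
    have "(norm (A e + B e))\<^sup>2 \<le> (norm (A e) + norm (B e))\<^sup>2"
      by (intro power_mono norm_triangle_ineq) simp
    also have "\<dots> \<le> 2 * ((norm (A e))\<^sup>2 + (norm (B e))\<^sup>2)"
      using sum_squares_bound[of "norm (A e)" "norm (B e)"] by (simp add: power2_sum)
    finally show "(norm (A e + B e))\<^sup>2 \<le> 2 * ((norm (A e))\<^sup>2 + (norm (B e))\<^sup>2)" .
  qed simp
qed

lemma hilbert_schmidt_scale:
  assumes A: "hilbert_schmidt A"
  shows "hilbert_schmidt (\<lambda>x. c *\<^sub>C A x)"
proof (rule hilbert_schmidtI)
  show "((\<lambda>e. (norm (c *\<^sub>C A e))\<^sup>2) has_sum (cmod c)\<^sup>2 * (hs_norm A)\<^sup>2) some_onb"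
    using has_sum_cmult_right[OF hs_norm_some[OF A]] by (simp add: power_mult_distrib)
qed (use A in \<open>auto intro: hilbert_schmidt_onb bounded_clinear_scale hilbert_schmidt_bounded\<close>)

lemma hilbert_schmidt_minus:
  assumes A: "hilbert_schmidt A" and B: "hilbert_schmidt B"
  shows "hilbert_schmidt (\<lambda>x. A x - B x)"
proof -
  have "(- 1) *\<^sub>C x = - x" for x :: 'a using scaleC_of_real[of "-1" x] by simp
  then show ?thesis
    using hilbert_schmidt_plus[OF A hilbert_schmidt_scale[OF B, of "-1"]] by simp
qed

lemma hilbert_schmidt_compose_left:
  fixes A :: "'h::complex_hilbert \<Rightarrow> 'h"
  assumes X: "bounded_clinear X" and A: "hilbert_schmidt A"
  shows "hilbert_schmidt (X \<circ> A)"
  unfolding hilbert_schmidt_def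
proof (intro conjI exI)
  obtain K where K: "\<And>x. norm (X x) \<le> K * norm x" using bounded_clinear_bound[OF X] by metis
  show C: "orthonormal_basis (some_onb :: 'h set)" by (rule hilbert_schmidt_onb[OF A])
  show "(\<lambda>e. (norm ((X \<circ> A) e))\<^sup>2) summable_on some_onb"
  proof (rule summable_on_comparison_test)
    show "(\<lambda>e. K\<^sup>2 * (norm (A e))\<^sup>2) summable_on some_onb"
      by (intro summable_on_cmult_right hilbert_schmidt_summable A C)
    show "(norm ((X \<circ> A) e))\<^sup>2 \<le> K\<^sup>2 * (norm (A e))\<^sup>2" for e
      using power_mono[OF K[of "A e"], of 2] by (simp add: power_mult_distrib)
  qed simp
qed (intro bounded_clinear_compose X hilbert_schmidt_bounded A)

text \<open>A X is the adjoint of the product of the adjoint of X with the adjoint of A, to which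
  multiplication from the left applies.\<close>

lemma hilbert_schmidt_compose_right:
  assumes X: "bounded_clinear X" and A: "hilbert_schmidt A"
  shows "hilbert_schmidt (A \<circ> X)"
proof -
  have A': "bounded_clinear A" by (rule hilbert_schmidt_bounded[OF A])
  have "hilbert_schmidt (cadjoint (cadjoint X \<circ> cadjoint A))"
    by (intro hilbert_schmidt_cadjoint hilbert_schmidt_compose_left bounded_clinear_cadjoint X A)
  then show ?thesis
    by (simp add: cadjoint_compose bounded_clinear_cadjoint X A' cadjoint_cadjoint)
qed

lemma hs_norm_compose_left_isometry:
  assumes X: "bounded_clinear X" and A: "hilbert_schmidt A" and iso: "\<And>x. norm (X x) = norm x"
  shows "hs_norm (X \<circ> A) = hs_norm A"
proof -
  have "(hs_norm (X \<circ> A))\<^sup>2 = (hs_norm A)\<^sup>2"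
    using hs_norm_some[OF hilbert_schmidt_compose_left[OF X A]]
    by (rule has_sum_unique) (simp add: iso hs_norm_some[OF A])
  then show ?thesis
    by (rule power2_eq_imp_eq) (intro hs_norm_nonneg hilbert_schmidt_compose_left A X)+
qed

section \<open>The Hilbert-Schmidt inner product\<close>

lemma hs_inner_commute:
  assumes "hilbert_schmidt A" "hilbert_schmidt B"
  shows "hs_inner A B = cnj (hs_inner B A)"
proof -
  have "((\<lambda>e. cnj (cinner (B e) (A e))) has_sum cnj (hs_inner B A)) some_onb"
    using hs_inner_has_sum[OF assms(2,1)] by (simp add: has_sum_cnj_iff)
  then have "((\<lambda>e. cinner (A e) (B e)) has_sum cnj (hs_inner B A)) some_onb"
    by (simp only: cinner_commute[symmetric])
  then show ?thesis by (rule has_sum_unique[OF hs_inner_has_sum[OF assms]])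
qed

lemma hs_inner_add_right:
  assumes "hilbert_schmidt A" "hilbert_schmidt B" "hilbert_schmidt C"
  shows "hs_inner A (\<lambda>x. B x + C x) = hs_inner A B + hs_inner A C"
  using has_sum_add[OF hs_inner_has_sum[OF assms(1,2)] hs_inner_has_sum[OF assms(1,3)]]
  by (intro has_sum_unique[OF hs_inner_has_sum[OF assms(1) hilbert_schmidt_plus[OF assms(2,3)]]])
    (simp add: cinner_simps)

lemma hs_inner_add_left:
  assumes "hilbert_schmidt A" "hilbert_schmidt B" "hilbert_schmidt C"
  shows "hs_inner (\<lambda>x. A x + B x) C = hs_inner A C + hs_inner B C"
  using hs_inner_add_right[OF assms(3,1,2)]
  by (simp add: hs_inner_commute[OF hilbert_schmidt_plus[OF assms(1,2)] assms(3)]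
      hs_inner_commute[OF assms(1,3)] hs_inner_commute[OF assms(2,3)])

lemma hs_inner_scale_right:
  assumes "hilbert_schmidt A" "hilbert_schmidt B"
  shows "hs_inner A (\<lambda>x. c *\<^sub>C B x) = c * hs_inner A B"
  using has_sum_cmult_right[OF hs_inner_has_sum[OF assms], of c]
  by (intro has_sum_unique[OF hs_inner_has_sum[OF assms(1) hilbert_schmidt_scale[OF assms(2)]]])
    (simp add: cinner_simps)

lemma hs_inner_scale_left:
  assumes "hilbert_schmidt A" "hilbert_schmidt B"
  shows "hs_inner (\<lambda>x. c *\<^sub>C A x) B = cnj c * hs_inner A B"
  using hs_inner_scale_right[OF assms(2,1), of c]
  by (simp add: hs_inner_commute[OF hilbert_schmidt_scale[OF assms(1)] assms(2)]
      hs_inner_commute[OF assms(1,2)])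

lemma hs_inner_diff_right:
  assumes "hilbert_schmidt A" "hilbert_schmidt B" "hilbert_schmidt C"
  shows "hs_inner A (\<lambda>x. B x - C x) = hs_inner A B - hs_inner A C"
  using hs_inner_add_right[OF assms(1) hilbert_schmidt_minus[OF assms(2,3)] assms(3)] by simp

lemma cmod_hs_inner_le:
  assumes A: "hilbert_schmidt A" and B: "hilbert_schmidt B"
  shows "cmod (hs_inner A B) \<le> hs_norm A * hs_norm B"
proof -
  have onb: "orthonormal_basis (some_onb :: 'a set)" by (rule hilbert_schmidt_onb[OF A])
  have abs: "(\<lambda>e. cmod (cinner (A e) (B e))) summable_on some_onb"
    by (rule hilbert_schmidt_abs_summable[OF A B onb])
  have "cmod (hs_inner A B) \<le> (\<Sum>\<^sub>\<infinity>e\<in>some_onb. cmod (cinner (A e) (B e)))"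
    using norm_has_sum_bound[OF has_sum_infsum[OF abs] hs_inner_has_sum[OF A B]] .
  also have "\<dots> \<le> hs_norm A * hs_norm B"
  proof (rule infsum_le_finite_sums[OF abs])
    fix F :: "'a set" assume F: "finite F" "F \<subseteq> some_onb"
    have "(\<Sum>e\<in>F. cmod (cinner (A e) (B e))) \<le> (\<Sum>e\<in>F. \<bar>norm (A e)\<bar> * \<bar>norm (B e)\<bar>)"
      by (intro sum_mono) (simp add: cmod_cinner_le)
    also have "\<dots> \<le> L2_set (\<lambda>e. norm (A e)) F * L2_set (\<lambda>e. norm (B e)) F"
      by (rule L2_set_mult_ineq)
    also have "\<dots> \<le> hs_norm A * hs_norm B"
      unfolding L2_set_def
      using hs_norm_some[OF A] hs_norm_some[OF B] F
      by (intro mult_mono real_le_lsqrt hs_norm_nonneg A B finite_sum_le_has_sum)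
        (auto intro: sum_nonneg)
    finally show "(\<Sum>e\<in>F. cmod (cinner (A e) (B e))) \<le> hs_norm A * hs_norm B" .
  qed
  finally show ?thesis .
qed

text \<open>Expresses inner products through norms, so that invariance of the norm under adjoints
  carries over to them.\<close>

lemma Re_hs_inner_polar:
  assumes A: "hilbert_schmidt A" and B: "hilbert_schmidt B"
  shows "Re (hs_inner A B) = ((hs_norm (\<lambda>x. A x + B x))\<^sup>2 - (hs_norm A)\<^sup>2 - (hs_norm B)\<^sup>2) / 2"
proof -
  note AB = hilbert_schmidt_plus[OF A B]
  have "hs_inner (\<lambda>x. A x + B x) (\<lambda>x. A x + B x) =
      hs_inner A A + hs_inner A B + (cnj (hs_inner A B) + hs_inner B B)"
    by (simp add: hs_inner_add_right hs_inner_add_left AB A B hs_inner_commute[OF B A])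
  from arg_cong[OF this, of Re] show ?thesis
    by (simp add: hs_inner_self AB A B)
qed

text \<open>Taking adjoints is antilinear and preserves the norm, hence exchanges the arguments;
  polarization avoids rearranging a double series. In terms of traces this is tr(XY) = tr(YX) for
  Hilbert-Schmidt X and Y.\<close>

lemma hs_inner_cadjoint:
  assumes A: "hilbert_schmidt A" and B: "hilbert_schmidt B"
  shows "hs_inner (cadjoint B) (cadjoint A) = hs_inner A B"
proof -
  have re: "Re (hs_inner (cadjoint B) (cadjoint A)) = Re (hs_inner A B)"
    if A: "hilbert_schmidt A" and B: "hilbert_schmidt B" for A B :: "'a \<Rightarrow> 'a"
  proof -
    have "cadjoint (\<lambda>x. A x + B x) = (\<lambda>x. cadjoint B x + cadjoint A x)"
      by (rule cadjoint_eqI)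
        (simp add: cinner_simps cinner_add_left cinner_cadjoint_left hilbert_schmidt_bounded A B)
    then have "hs_norm (\<lambda>x. cadjoint B x + cadjoint A x) = hs_norm (\<lambda>x. A x + B x)"
      using hs_norm_cadjoint[OF hilbert_schmidt_plus[OF A B]] by simp
    then show ?thesis
      by (simp add: Re_hs_inner_polar A B hilbert_schmidt_cadjoint hs_norm_cadjoint)
  qed
  \<comment> \<open>The real part of the product with - i B is the imaginary part of the product
    with B.\<close>
  have "cadjoint (\<lambda>x. (- \<i>) *\<^sub>C B x) = (\<lambda>x. \<i> *\<^sub>C cadjoint B x)"
    by (rule cadjoint_eqI)
      (simp add: cinner_scaleC_left cinner_scaleC_right cinner_cadjoint_left hilbert_schmidt_bounded B)
  then have "Im (hs_inner (cadjoint B) (cadjoint A)) = Im (hs_inner A B)"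
    using re[OF A hilbert_schmidt_scale[OF B, of "- \<i>"]]
    by (simp add: hs_inner_scale_right hs_inner_scale_left A B hilbert_schmidt_cadjoint)
  then show ?thesis using re[OF A B] by (simp add: complex_eq_iff)
qed

lemma hs_inner_compose_left:
  assumes X: "bounded_clinear X" and A: "hilbert_schmidt A" and B: "hilbert_schmidt B"
  shows "hs_inner (cadjoint X \<circ> A) B = hs_inner A (X \<circ> B)"
  using hs_inner_has_sum[OF hilbert_schmidt_compose_left[OF bounded_clinear_cadjoint[OF X] A] B]
  by (rule has_sum_unique)
    (simp add: cinner_cadjoint_left[OF X] hs_inner_has_sum[OF A hilbert_schmidt_compose_left[OF X B], simplified])

text \<open>Cyclicity of the trace. Passing to adjoints turns right multiplication into left
  multiplication, which can be moved across termwise in the sum over the basis.\<close>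

lemma hs_inner_compose_right:
  assumes X: "bounded_clinear X" and A: "hilbert_schmidt A" and B: "hilbert_schmidt B"
  shows "hs_inner (A \<circ> cadjoint X) B = hs_inner A (B \<circ> X)"
proof -
  note X' = bounded_clinear_cadjoint[OF X] and A' = hilbert_schmidt_bounded[OF A]
    and B' = hilbert_schmidt_bounded[OF B]
  have "hs_inner (A \<circ> cadjoint X) B = hs_inner (cadjoint B) (cadjoint (A \<circ> cadjoint X))"
    by (simp add: hs_inner_cadjoint hilbert_schmidt_compose_right X' A B)
  also have "\<dots> = hs_inner (cadjoint B) (X \<circ> cadjoint A)"
    by (simp add: cadjoint_compose A' X' cadjoint_cadjoint X)
  also have "\<dots> = hs_inner (cadjoint (B \<circ> X)) (cadjoint A)"
    by (simp add: hs_inner_compose_left hilbert_schmidt_cadjoint X A B cadjoint_compose B')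
  also have "\<dots> = hs_inner A (B \<circ> X)"
    by (simp add: hs_inner_cadjoint hilbert_schmidt_compose_right X A B)
  finally show ?thesis .
qed

text \<open>Every value of the adjoint is orthogonal to B and therefore zero; this replaces a
  density argument for the span of B.\<close>

lemma bounded_clinear_eq_0_on_onb:
  assumes A: "bounded_clinear A" and B: "orthonormal_basis B" and "\<And>e. e \<in> B \<Longrightarrow> A e = 0"
  shows "A x = 0"
proof (rule cinner_eq_all_imp_eq)
  fix y
  have "cinner e (cadjoint A y) = 0" if "e \<in> B" for e
    using assms(3)[OF that] by (simp add: cinner_cadjoint_right[OF A])
  then have "cadjoint A y = 0" using B by (simp add: orthonormal_basis_def)
  then show "cinner y (A x) = cinner y 0"
    by (simp add: cinner_cadjoint_left[OF A, symmetric])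
qed

lemma hs_norm_eq_0:
  assumes A: "hilbert_schmidt A" and "hs_norm A = 0"
  shows "A x = 0"
proof (rule bounded_clinear_eq_0_on_onb[OF hilbert_schmidt_bounded[OF A] hilbert_schmidt_onb[OF A]])
  fix e assume e: "e \<in> (some_onb :: 'a set)"
  have "((\<lambda>e. (norm (A e))\<^sup>2) has_sum 0) some_onb"
    using hs_norm_some[OF A] assms(2) by simp
  then have "(norm (A e))\<^sup>2 = 0"
    using nonneg_has_sum_le_0D[of "\<lambda>e. (norm (A e))\<^sup>2" some_onb 0 e] e by simp
  then show "A e = 0" by simp
qed

text \<open>Testing against A - B reduces this to definiteness of the norm. It provides the
  uniqueness in \<open>quantize\<close>.\<close>

lemma hs_eqI:
  assumes A: "hilbert_schmidt A" and B: "hilbert_schmidt B"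
    and eq: "\<And>C. hilbert_schmidt C \<Longrightarrow> hs_inner C A = hs_inner C B"
  shows "A = B"
proof
  fix x
  note D = hilbert_schmidt_minus[OF A B]
  have "hs_inner (\<lambda>x. A x - B x) (\<lambda>x. A x - B x) = 0"
    using eq[OF D] by (simp add: hs_inner_diff_right D A B)
  then have "hs_norm (\<lambda>x. A x - B x) = 0" by (simp add: hs_norm_def)
  from hs_norm_eq_0[OF D this, of x] show "A x = B x" by simp
qed

subsection \<open>Approximation by operators of finite rank\<close>

text \<open>The operator |t><s| of Dirac notation, linear in t and antilinear in s.\<close>

definition rank1 :: "'h::complex_hilbert \<Rightarrow> 'h \<Rightarrow> 'h \<Rightarrow> 'h"
  where "rank1 t s x = cinner s x *\<^sub>C t"

lemma bounded_clinear_rank1: "bounded_clinear (rank1 t s)"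
proof (rule bounded_clinearI[where K="norm t * norm s"])
  show "norm (rank1 t s x) \<le> norm t * norm s * norm x" for x
    using mult_left_mono[OF cmod_cinner_le[of s x], of "norm t"] by (simp add: rank1_def mult_ac)
qed (simp_all add: rank1_def cinner_simps scaleC_add_left scaleC_scaleC)

lemma
  assumes B: "orthonormal_basis (B :: 'h::complex_hilbert set)"
  shows hilbert_schmidt_rank1: "hilbert_schmidt (rank1 t (s::'h))" and hs_norm_rank1: "hs_norm (rank1 t s) = norm t * norm s"
proof -
  have sum: "((\<lambda>e. (norm (rank1 t s e))\<^sup>2) has_sum (norm t * norm s)\<^sup>2) C"
    if C: "orthonormal_basis C" for C
  proof -
    have "cmod (cinner s e) = cmod (cinner e s)" for e
      by (metis cinner_commute complex_mod_cnj)
    then show ?thesis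
      using has_sum_cmult_right[OF parseval_norm[OF C, of s], of "(norm t)\<^sup>2"]
      by (simp add: rank1_def power_mult_distrib mult.commute)
  qed
  show hs: "hilbert_schmidt (rank1 t s)"
    by (rule hilbert_schmidtI[OF bounded_clinear_rank1 B sum[OF B]])
  have "(hs_norm (rank1 t s))\<^sup>2 = (norm t * norm s)\<^sup>2"
    by (rule has_sum_unique[OF hs_norm_has_sum[OF hs B] sum[OF B]])
  then show "hs_norm (rank1 t s) = norm t * norm s"
    by (rule power2_eq_imp_eq) (simp_all add: hs_norm_nonneg[OF hs])
qed

text \<open>The sum over the basis is Parseval's identity for s and the adjoint of A at t.\<close>

lemma hs_inner_rank1_right:
  assumes A: "hilbert_schmidt A"
  shows "hs_inner A (rank1 t s) = cinner (A s) t"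
proof -
  note A' = hilbert_schmidt_bounded[OF A] and B = hilbert_schmidt_onb[OF A]
  have "cinner (A e) (rank1 t s e) = cinner s e * cinner e (cadjoint A t)" for e
    by (simp add: rank1_def cinner_scaleC_right cinner_cadjoint_right[OF A'])
  then have "((\<lambda>e. cinner (A e) (rank1 t s e)) has_sum cinner s (cadjoint A t)) some_onb"
    using parseval[OF B, of s "cadjoint A t"] by simp
  then show ?thesis
    unfolding cinner_cadjoint_right[OF A']
    by (rule has_sum_unique[OF hs_inner_has_sum[OF A hilbert_schmidt_rank1[OF B]]])
qed

lemma hs_inner_rank1_left:
  assumes A: "hilbert_schmidt A"
  shows "hs_inner (rank1 t s) A = cinner t (A s)"
  unfolding hs_inner_commute[OF hilbert_schmidt_rank1[OF hilbert_schmidt_onb[OF A]] A]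
    hs_inner_rank1_right[OF A] by (rule cinner_commute[symmetric])

text \<open>For linear A and orthonormal S this is A after the orthogonal projection onto the span
  of S. Written as a sum of rank one operators, it can be split by any additive functional.\<close>

definition truncate_op :: "'h::complex_hilbert set \<Rightarrow> ('h \<Rightarrow> 'h) \<Rightarrow> 'h \<Rightarrow> 'h"
  where "truncate_op S A x = (\<Sum>e\<in>S. rank1 (A e) e x)"

lemma hilbert_schmidt_truncate:
  assumes B: "orthonormal_basis (B :: 'h::complex_hilbert set)" and "finite S"
  shows "hilbert_schmidt (truncate_op S (A :: 'h \<Rightarrow> 'h))"
  using assms(2)
proof (induction S)
  case empty
  have "truncate_op {} A = rank1 0 0" by (auto simp: truncate_op_def rank1_def)
  then show ?case using hilbert_schmidt_rank1[OF B] by metis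
next
  case (insert e S)
  have "truncate_op (insert e S) A = (\<lambda>x. rank1 (A e) e x + truncate_op S A x)"
    using insert by (auto simp: truncate_op_def)
  then show ?case
    using hilbert_schmidt_plus[OF hilbert_schmidt_rank1[OF B] insert.IH] by metis
qed

lemma truncate_op_onb:
  assumes B: "orthonormal_basis B" and S: "finite S" "S \<subseteq> B" and b: "b \<in> B"
  shows "truncate_op S A b = (if b \<in> S then A b else 0)"
proof -
  have "rank1 (A e) e b = (if e = b then A b else 0)" if "e \<in> S" for e
    using B that S b by (auto simp: rank1_def orthonormal_basis_def)
  then show ?thesis
    using S(1) by (simp add: truncate_op_def)
qed

lemma hs_norm_truncate_op:
  assumes B: "orthonormal_basis B" and S: "finite S" "S \<subseteq> B"
  shows "(hs_norm (truncate_op S A))\<^sup>2 = (\<Sum>e\<in>S. (norm (A e))\<^sup>2)"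
proof (rule has_sum_unique[OF hs_norm_has_sum[OF hilbert_schmidt_truncate[OF B S(1)] B]])
  show "((\<lambda>e. (norm (truncate_op S A e))\<^sup>2) has_sum (\<Sum>e\<in>S. (norm (A e))\<^sup>2)) B"
    by (rule has_sum_finite_neutralI[OF S(1)]) 
      (use S in \<open>auto simp: truncate_op_onb[OF B S] subset_iff intro!: sum.cong\<close>)
qed

lemma hs_norm_minus_truncate_op:
  assumes A: "hilbert_schmidt A" and B: "orthonormal_basis B" and S: "finite S" "S \<subseteq> B"
  shows "(hs_norm (\<lambda>x. A x - truncate_op S A x))\<^sup>2 = (hs_norm A)\<^sup>2 - (\<Sum>e\<in>S. (norm (A e))\<^sup>2)"
proof -
  note D = hilbert_schmidt_minus[OF A hilbert_schmidt_truncate[OF B S(1)]]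
  note tr = truncate_op_onb[OF B S]
  have "((\<lambda>e. if e \<in> S then (norm (A e))\<^sup>2 else 0) has_sum (\<Sum>e\<in>S. (norm (A e))\<^sup>2)) B"
    by (rule has_sum_finite_neutralI[OF S(1)]) (use S in auto)
  then have "((\<lambda>e. - (if e \<in> S then (norm (A e))\<^sup>2 else 0)) has_sum - (\<Sum>e\<in>S. (norm (A e))\<^sup>2)) B"
    by (simp only: has_sum_uminus minus_minus)
  from has_sum_add[OF hs_norm_has_sum[OF A B] this]
  have "((\<lambda>e. (norm (A e - truncate_op S A e))\<^sup>2) has_sum
      (hs_norm A)\<^sup>2 - (\<Sum>e\<in>S. (norm (A e))\<^sup>2)) B"
    by (subst has_sum_cong[where g="\<lambda>e. (norm (A e))\<^sup>2 + - (if e \<in> S then (norm (A e))\<^sup>2 else 0)"])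
      (simp_all add: tr)
  then show ?thesis by (rule has_sum_unique[OF hs_norm_has_sum[OF D B]])
qed

text \<open>The squared distance is the tail of the convergent series in
  \<open>hs_norm_has_sum\<close>.\<close>

lemma tendsto_hs_norm_truncate:
  assumes A: "hilbert_schmidt A" and B: "orthonormal_basis B"
  shows "((\<lambda>S. hs_norm (\<lambda>x. A x - truncate_op S A x)) \<longlongrightarrow> 0) (finite_subsets_at_top B)"
proof -
  have "((\<lambda>S. sqrt ((hs_norm A)\<^sup>2 - (\<Sum>e\<in>S. (norm (A e))\<^sup>2))) \<longlongrightarrow>
      sqrt ((hs_norm A)\<^sup>2 - (hs_norm A)\<^sup>2)) (finite_subsets_at_top B)"
    using hs_norm_has_sum[OF A B] unfolding has_sum_def
    by (intro tendsto_real_sqrt tendsto_diff tendsto_const)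
  moreover have "\<forall>\<^sub>F S in finite_subsets_at_top B.
      sqrt ((hs_norm A)\<^sup>2 - (\<Sum>e\<in>S. (norm (A e))\<^sup>2)) = hs_norm (\<lambda>x. A x - truncate_op S A x)"
  proof (rule eventually_finite_subsets_at_top_weakI)
    fix S assume S: "finite S" "S \<subseteq> B"
    have "hs_norm (\<lambda>x. A x - truncate_op S A x) \<ge> 0"
      by (intro hs_norm_nonneg hilbert_schmidt_minus A hilbert_schmidt_truncate[OF B S(1)])
    then show "sqrt ((hs_norm A)\<^sup>2 - (\<Sum>e\<in>S. (norm (A e))\<^sup>2)) = hs_norm (\<lambda>x. A x - truncate_op S A x)"
      by (simp add: hs_norm_minus_truncate_op[OF A B S, symmetric])
  qed
  ultimately show ?thesis by (simp add: tendsto_cong[THEN iffD1])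
qed

section \<open>Bounded functionals on Hilbert-Schmidt operators and the Riesz theorem for
  them\<close>

lemma hs_additive_truncate:
  fixes F :: "('h::complex_hilbert \<Rightarrow> 'h) \<Rightarrow> complex"
  assumes add: "\<And>A B. hilbert_schmidt A \<Longrightarrow> hilbert_schmidt B \<Longrightarrow> F (\<lambda>x. A x + B x) = F A + F B"
    and B: "orthonormal_basis (B :: 'h set)" and "finite S"
  shows "F (truncate_op S A) = (\<Sum>e\<in>S. F (rank1 (A e) e))"
  using assms(3)
proof (induction S)
  case empty
  have "truncate_op {} A = rank1 0 0" by (auto simp: truncate_op_def rank1_def)
  moreover have "(\<lambda>x. rank1 0 0 x + rank1 0 0 x) = (rank1 0 0 :: 'h \<Rightarrow> 'h)"
    by (auto simp: rank1_def)
  \<comment> \<open>Additivity forces the value 0 at the zero operator, as 0 + 0 = 0.\<close>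
  then have "F (rank1 0 0) = 0"
    using add[OF hilbert_schmidt_rank1[OF B] hilbert_schmidt_rank1[OF B], of 0 0 0 0] by simp
  ultimately show ?case by simp
next
  case (insert e S)
  have "truncate_op (insert e S) A = (\<lambda>x. rank1 (A e) e x + truncate_op S A x)"
    using insert by (auto simp: truncate_op_def)
  then show ?case
    using add[OF hilbert_schmidt_rank1[OF B] hilbert_schmidt_truncate[OF B insert.hyps(1)],
        of "A e" e A] insert.IH insert.hyps
    by simp
qed

text \<open>Boundedness makes F continuous along the truncations of A, and additivity evaluates it
  on them. Scalars sit inside the vectors A e, so linear and antilinear F are covered alike.\<close>

lemma hs_functional_has_sum:
  fixes F :: "('h::complex_hilbert \<Rightarrow> 'h) \<Rightarrow> complex"
  assumes add: "\<And>A B. hilbert_schmidt A \<Longrightarrow> hilbert_schmidt B \<Longrightarrow> F (\<lambda>x. A x + B x) = F A + F B"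
    and bound: "\<And>A. hilbert_schmidt A \<Longrightarrow> cmod (F A) \<le> K * hs_norm A"
    and A: "hilbert_schmidt A" and B: "orthonormal_basis B"
  shows "((\<lambda>e. F (rank1 (A e) e)) has_sum F A) B"
proof -
  have "((\<lambda>S. (\<Sum>e\<in>S. F (rank1 (A e) e)) - F A) \<longlongrightarrow> 0) (finite_subsets_at_top B)"
  proof (rule tendsto_0_le)
    show "((\<lambda>S. hs_norm (\<lambda>x. A x - truncate_op S A x)) \<longlongrightarrow> 0) (finite_subsets_at_top B)"
      by (rule tendsto_hs_norm_truncate[OF A B])
    show "\<forall>\<^sub>F S in finite_subsets_at_top B. norm ((\<Sum>e\<in>S. F (rank1 (A e) e)) - F A)
        \<le> norm (hs_norm (\<lambda>x. A x - truncate_op S A x)) * K"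
    proof (rule eventually_finite_subsets_at_top_weakI)
      fix S assume S: "finite S" "S \<subseteq> B"
      note T = hilbert_schmidt_truncate[OF B S(1), of A]
      note D = hilbert_schmidt_minus[OF A T]
      have "F (truncate_op S A) = (\<Sum>e\<in>S. F (rank1 (A e) e))"
        by (rule hs_additive_truncate[OF _ B S(1)]) (rule add)
      moreover have "F A = F (\<lambda>x. A x - truncate_op S A x) + F (truncate_op S A)"
        using add[OF D T] by simp
      ultimately have "(\<Sum>e\<in>S. F (rank1 (A e) e)) - F A = - F (\<lambda>x. A x - truncate_op S A x)"
        by simp
      then have "norm ((\<Sum>e\<in>S. F (rank1 (A e) e)) - F A) = norm (F (\<lambda>x. A x - truncate_op S A x))"
        by (simp only: norm_minus_cancel)
      also have "\<dots> \<le> hs_norm (\<lambda>x. A x - truncate_op S A x) * K"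
        using bound[OF D] by (simp only: mult.commute)
      finally show "norm ((\<Sum>e\<in>S. F (rank1 (A e) e)) - F A)
          \<le> norm (hs_norm (\<lambda>x. A x - truncate_op S A x)) * K"
        using hs_norm_nonneg[OF D] by (simp only: real_norm_def abs_of_nonneg)
    qed
  qed
  then show ?thesis
    unfolding has_sum_def by (rule LIM_zero_cancel)
qed

text \<open>Both functionals are sums of the same series over rank one pieces of A. Identities known
  for rank one operators are extended in this way, one argument at a time.\<close>

lemma hs_functional_eqI:
  fixes F G :: "('h::complex_hilbert \<Rightarrow> 'h) \<Rightarrow> complex"
  assumes "\<And>A B. hilbert_schmidt A \<Longrightarrow> hilbert_schmidt B \<Longrightarrow> F (\<lambda>x. A x + B x) = F A + F B"
    and "\<And>A. hilbert_schmidt A \<Longrightarrow> cmod (F A) \<le> K * hs_norm A"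
    and "\<And>A B. hilbert_schmidt A \<Longrightarrow> hilbert_schmidt B \<Longrightarrow> G (\<lambda>x. A x + B x) = G A + G B"
    and "\<And>A. hilbert_schmidt A \<Longrightarrow> cmod (G A) \<le> L * hs_norm A"
    and eq: "\<And>t s. F (rank1 t s) = G (rank1 t s)"
    and A: "hilbert_schmidt A"
  shows "F A = G A"
proof -
  have B: "orthonormal_basis (some_onb :: 'h set)" by (rule hilbert_schmidt_onb[OF A])
  have "((\<lambda>e. F (rank1 (A e) e)) has_sum F A) some_onb"
    by (rule hs_functional_has_sum[of F, OF assms(1,2) A B])
  moreover have "((\<lambda>e. F (rank1 (A e) e)) has_sum G A) some_onb"
    unfolding eq by (rule hs_functional_has_sum[of G, OF assms(3,4) A B])
  ultimately show ?thesis by (rule has_sum_unique)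
qed

lemma rank1_add_left: "rank1 (x + y) s = (\<lambda>z. rank1 x s z + rank1 y s z)"
  and rank1_add_right: "rank1 t (x + y) = (\<lambda>z. rank1 t x z + rank1 t y z)"
  and rank1_scale_left: "rank1 (c *\<^sub>C t) s = (\<lambda>z. c *\<^sub>C rank1 t s z)"
  and rank1_scale_right: "rank1 t (c *\<^sub>C s) = (\<lambda>z. cnj c *\<^sub>C rank1 t s z)"
  by (simp_all add: rank1_def fun_eq_iff scaleC_add_right scaleC_add_left cinner_add_left
      cinner_scaleC_left scaleC_scaleC mult.commute)

text \<open>Q is determined by its matrix entries, \<open>cinner x (Q y) = F (rank1 x y)\<close>,
  where each y is an instance of Riesz in the underlying space. Square summability of Q then has to
  be extracted from the bound on F.\<close>

lemma hs_riesz: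
  fixes F :: "('h::complex_hilbert \<Rightarrow> 'h) \<Rightarrow> complex"
  assumes add: "\<And>A B. hilbert_schmidt A \<Longrightarrow> hilbert_schmidt B \<Longrightarrow> F (\<lambda>x. A x + B x) = F A + F B"
    and scale: "\<And>c A. hilbert_schmidt A \<Longrightarrow> F (\<lambda>x. c *\<^sub>C A x) = cnj c * F A"
    and bound: "\<And>A. hilbert_schmidt A \<Longrightarrow> cmod (F A) \<le> K * hs_norm A"
    and B: "orthonormal_basis (B :: 'h set)"
  shows "\<exists>Q. hilbert_schmidt Q \<and> (\<forall>A. hilbert_schmidt A \<longrightarrow> hs_inner A Q = F A)"
proof -
  note r1 = hilbert_schmidt_rank1[OF B]
  have r1_bound: "cmod (F (rank1 x y)) \<le> K * norm y * norm x" for x y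
    using bound[OF r1, of x y] by (simp add: hs_norm_rank1[OF B] mult_ac)
  \<comment> \<open>F is antilinear; the conjugate makes the functional linear in x, as
    \<open>riesz\<close> requires.\<close>
  have "\<exists>z. \<forall>x. cnj (F (rank1 x y)) = cinner z x" for y
  proof (rule riesz)
    show "cnj (F (rank1 (x + x') y)) = cnj (F (rank1 x y)) + cnj (F (rank1 x' y))" for x x'
      by (simp add: rank1_add_left add r1)
    show "cnj (F (rank1 (c *\<^sub>C x) y)) = c * cnj (F (rank1 x y))" for c x
      by (simp add: rank1_scale_left scale r1)
    show "cmod (cnj (F (rank1 x y))) \<le> K * norm y * norm x" for x
      using r1_bound by simp
  qed
  then obtain Q where "\<And>x y. cnj (F (rank1 x y)) = cinner (Q y) x" by metis
  then have Q: "cinner x (Q y) = F (rank1 x y)" for x y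
    by (metis cinner_commute complex_cnj_cnj)
  \<comment> \<open>On these operators F returns squared norms of Q; the boundedness and the square
    summability of Q both come from here.\<close>
  have self: "complex_of_real ((norm (Q y))\<^sup>2) = F (rank1 (Q y) y)" for y
    by (simp only: Q[symmetric] cinner_self)
  have bd: "bounded_clinear Q"
  \<comment> \<open>The absolute value covers \<open>norm (Q y) = 0\<close>, where nothing can be
    cancelled and the sign of K is open.\<close>
  proof (rule bounded_clinearI[where K="\<bar>K\<bar>"])
    show "Q (x + y) = Q x + Q y" for x y
      by (rule cinner_eq_all_imp_eq) (simp add: Q cinner_add_right rank1_add_right add r1)
    show "Q (c *\<^sub>C x) = c *\<^sub>C Q x" for c x
      by (rule cinner_eq_all_imp_eq) (simp add: Q cinner_scaleC_right rank1_scale_right scale r1)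
    fix y
    have "cmod (complex_of_real ((norm (Q y))\<^sup>2)) \<le> K * norm y * norm (Q y)"
      unfolding self by (rule r1_bound)
    then have "norm (Q y) * norm (Q y) \<le> (K * norm y) * norm (Q y)"
      by (simp only: norm_of_real abs_of_nonneg zero_le_power2) (simp add: power2_eq_square)
    then have "norm (Q y) \<le> K * norm y \<or> norm (Q y) = 0"
      by (metis mult_le_cancel_right norm_ge_zero order_less_le)
    moreover have "K * norm y \<le> \<bar>K\<bar> * norm y" by (intro mult_right_mono) auto
    moreover have "0 \<le> \<bar>K\<bar> * norm y" by simp
    ultimately show "norm (Q y) \<le> \<bar>K\<bar> * norm y" by linarith
  qed
  \<comment> \<open>F is tested on the truncation of Q itself: the value is N^2 and the bound reads
    N^2 <= K * N, which limits the partial sums uniformly in S. Q is not yet known to be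
    Hilbert-Schmidt here, but its truncations are.\<close>
  have "(\<Sum>e\<in>S. (norm (Q e))\<^sup>2) \<le> K\<^sup>2" if S: "finite S" "S \<subseteq> B" for S
  proof -
    define N where "N = hs_norm (truncate_op S Q)"
    note T = hilbert_schmidt_truncate[OF B S(1), of Q]
    have N: "N\<^sup>2 = (\<Sum>e\<in>S. (norm (Q e))\<^sup>2)" and N0: "N \<ge> 0"
      unfolding N_def by (rule hs_norm_truncate_op[OF B S]) (rule hs_norm_nonneg[OF T])
    have "F (truncate_op S Q) = (\<Sum>e\<in>S. F (rank1 (Q e) e))"
      by (rule hs_additive_truncate[OF _ B S(1)]) (rule add)
    also have "\<dots> = complex_of_real (N\<^sup>2)"
      unfolding N by (simp only: self[symmetric] of_real_sum)
    finally have "N\<^sup>2 \<le> K * N"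
      using bound[OF T] by (simp add: N_def[symmetric] norm_power)
    then have "N \<le> K \<or> N = 0"
      using N0 by (metis mult_le_cancel_right order_less_le power2_eq_square)
    then have "N\<^sup>2 \<le> K\<^sup>2"
      using N0 by (auto intro: power_mono)
    then show ?thesis by (simp only: N)
  qed
  then have "(\<lambda>e. (norm (Q e))\<^sup>2) summable_on B"
    by (intro nonneg_bdd_above_summable_on) (auto simp: bdd_above_def)
  then have hsQ: "hilbert_schmidt Q"
    using bd B by (auto simp: hilbert_schmidt_def)
  have "hs_inner A Q = F A" if A: "hilbert_schmidt A" for A
  proof (rule hs_functional_eqI[of "\<lambda>A. hs_inner A Q", OF _ _ add bound _ A])
    show "cmod (hs_inner A Q) \<le> hs_norm Q * hs_norm A" if "hilbert_schmidt A" for A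
      using cmod_hs_inner_le[OF that hsQ] by (simp add: mult.commute)
  qed (simp_all add: hs_inner_add_left hsQ hs_inner_rank1_left Q)
  then show ?thesis using hsQ by blast
qed

section \<open>Square integrable functions\<close>

lemma L2_borel: "f \<in> L2 M \<Longrightarrow> f \<in> borel_measurable M"
  and L2_square_integrable: "f \<in> L2 M \<Longrightarrow> integrable M (\<lambda>x. (cmod (f x))\<^sup>2)"
  by (auto simp: L2_def)

lemma L2_cmod_mult_integrable:
  assumes f: "f \<in> L2 M" and h: "h \<in> L2 M"
  shows "integrable M (\<lambda>x. cmod (f x) * cmod (h x))"
proof (rule Bochner_Integration.integrable_bound)
  show "integrable M (\<lambda>x. (cmod (f x))\<^sup>2 + (cmod (h x))\<^sup>2)"
    using f h by (simp add: L2_def)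
  show "(\<lambda>x. cmod (f x) * cmod (h x)) \<in> borel_measurable M"
    using f h by (auto simp: L2_def)
  show "AE x in M. norm (cmod (f x) * cmod (h x)) \<le> norm ((cmod (f x))\<^sup>2 + (cmod (h x))\<^sup>2)"
  proof (rule AE_I2)
    fix x
    have "2 * (cmod (f x) * cmod (h x)) \<le> (cmod (f x))\<^sup>2 + (cmod (h x))\<^sup>2"
      "0 \<le> cmod (f x) * cmod (h x)"
      using sum_squares_bound[of "cmod (f x)" "cmod (h x)"] by (simp_all add: mult.assoc)
    then have "cmod (f x) * cmod (h x) \<le> (cmod (f x))\<^sup>2 + (cmod (h x))\<^sup>2" by linarith
    then show "norm (cmod (f x) * cmod (h x)) \<le> norm ((cmod (f x))\<^sup>2 + (cmod (h x))\<^sup>2)"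
      by simp
  qed
qed

lemma L2_mult_integrable:
  assumes f: "f \<in> L2 M" and h: "h \<in> L2 M"
  shows "integrable M (\<lambda>x. cnj (f x) * h x)"
proof (rule Bochner_Integration.integrable_bound[OF L2_cmod_mult_integrable[OF f h]])
  have [measurable]: "f \<in> borel_measurable M" "h \<in> borel_measurable M"
    using f h by (auto simp: L2_def)
  have "(\<lambda>x. cnj (f x)) \<in> borel_measurable M"
    by (intro borel_measurable_continuous_on[of cnj] continuous_intros) simp
  then show "(\<lambda>x. cnj (f x) * h x) \<in> borel_measurable M"
    by simp
qed (simp add: norm_mult)

lemma L2_inner_cauchy_schwarz:
  assumes f: "f \<in> L2 M" and h: "h \<in> L2 M"
  shows "cmod (L2_inner M f h) \<le> sqrt (LINT x|M. (cmod (f x))\<^sup>2) * sqrt (LINT x|M. (cmod (h x))\<^sup>2)"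
proof -
  define a b c where "a = (LINT x|M. (cmod (f x))\<^sup>2)" and "b = (LINT x|M. (cmod (h x))\<^sup>2)"
    and "c = (LINT x|M. cmod (f x) * cmod (h x))"
  have a0: "a \<ge> 0" and c0: "c \<ge> 0"
    by (simp_all add: a_def c_def integral_nonneg_AE)
  \<comment> \<open>The difference of the integrands is the square of
    \<open>t * cmod (f x) - cmod (h x)\<close>; Cauchy-Schwarz follows by choosing t.\<close>
  have quad: "2 * t * c \<le> t\<^sup>2 * a + b" for t
  proof -
    have "(LINT x|M. (2 * t) * (cmod (f x) * cmod (h x))) \<le>
        (LINT x|M. t\<^sup>2 * (cmod (f x))\<^sup>2 + (cmod (h x))\<^sup>2)"
    proof (rule integral_mono)
      show "(2 * t) * (cmod (f x) * cmod (h x)) \<le> t\<^sup>2 * (cmod (f x))\<^sup>2 + (cmod (h x))\<^sup>2" for x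
        using sum_squares_bound[of "t * cmod (f x)" "cmod (h x)"]
        by (simp add: power_mult_distrib mult_ac)
    qed (use L2_cmod_mult_integrable[OF f h] L2_square_integrable[OF f] L2_square_integrable[OF h] in auto)
    then show ?thesis
      using L2_square_integrable[OF f] L2_square_integrable[OF h] by (simp add: a_def b_def c_def)
  qed
  have "c\<^sup>2 \<le> a * b"
  proof (cases "a = 0")
    case True
    have "c = 0"
    proof (rule ccontr)
      assume "c \<noteq> 0"
      \<comment> \<open>With a = 0 the bound \<open>quad\<close> says 2 * t * c <= b for all t, and
        this t makes the left side b + 1.\<close>
      then have "2 * ((b + 1) / (2 * c)) * c = b + 1" by simp
      then show False using quad[of "(b + 1) / (2 * c)"] True by simp
    qed
    then show ?thesis using True by simp
  next
    case False
    \<comment> \<open>t = c / a minimises t^2 * a - 2 * t * c + b.\<close>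
    have "2 * (c / a) * c = 2 * (c\<^sup>2 / a)" "(c / a)\<^sup>2 * a = c\<^sup>2 / a"
      using False by (simp_all add: power2_eq_square)
    then have "c\<^sup>2 / a \<le> b" using quad[of "c / a"] by linarith
    then show ?thesis using False a0 by (simp add: divide_simps mult.commute split: if_splits)
  qed
  then have "c \<le> sqrt a * sqrt b"
    using c0 by (simp add: real_le_rsqrt real_sqrt_mult[symmetric])
  moreover have "cmod (L2_inner M f h) \<le> c"
    unfolding L2_inner_def c_def
    using integral_norm_bound[of M "\<lambda>x. cnj (f x) * h x"] by (simp add: norm_mult)
  ultimately show ?thesis by (simp add: a_def b_def)
qed

lemma L2_inner_add_left:
  assumes "f \<in> L2 M" "f' \<in> L2 M" "h \<in> L2 M"
  shows "L2_inner M (\<lambda>x. f x + f' x) h = L2_inner M f h + L2_inner M f' h"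
  unfolding L2_inner_def
  by (simp add: distrib_right L2_mult_integrable assms)

lemma L2_inner_add_right:
  assumes "f \<in> L2 M" "h \<in> L2 M" "h' \<in> L2 M"
  shows "L2_inner M f (\<lambda>x. h x + h' x) = L2_inner M f h + L2_inner M f h'"
  unfolding L2_inner_def
  by (simp add: distrib_left L2_mult_integrable assms)

text \<open>Bounded norms take the place of a dominating function, and measurability of Y comes from
  the pointwise limit. In exchange only an inequality survives.\<close>

lemma L2_fatou:
  assumes X: "\<And>n. X n \<in> L2 M" and lim: "\<And>x. (\<lambda>n. X n x) \<longlonglongrightarrow> Y x"
    and C: "\<And>n. (LINT x|M. (cmod (X n x))\<^sup>2) \<le> C"
  shows "Y \<in> L2 M" and "(LINT x|M. (cmod (Y x))\<^sup>2) \<le> C"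
proof -
  have Xm [measurable]: "X n \<in> borel_measurable M" for n by (rule L2_borel[OF X])
  have Ym [measurable]: "Y \<in> borel_measurable M"
    by (rule borel_measurable_LIMSEQ_metric[OF Xm lim])
  have C0: "C \<ge> 0" by (rule order_trans[OF _ C[of 0]]) simp
  have "(\<lambda>n. ennreal ((cmod (X n x))\<^sup>2)) \<longlonglongrightarrow> ennreal ((cmod (Y x))\<^sup>2)" for x
    by (rule tendsto_ennrealI[OF tendsto_power[OF tendsto_norm[OF lim]]])
  then have "(\<integral>\<^sup>+x. ennreal ((cmod (Y x))\<^sup>2) \<partial>M) = (\<integral>\<^sup>+x. liminf (\<lambda>n. ennreal ((cmod (X n x))\<^sup>2)) \<partial>M)"
    by (intro nn_integral_cong lim_imp_Liminf[symmetric] trivial_limit_sequentially)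
  also have "\<dots> \<le> liminf (\<lambda>n. \<integral>\<^sup>+x. ennreal ((cmod (X n x))\<^sup>2) \<partial>M)"
    by (rule nn_integral_liminf) simp
  also have "\<dots> \<le> liminf (\<lambda>n::nat. ennreal C)"
  proof (rule Liminf_mono, rule always_eventually, rule allI)
    show "(\<integral>\<^sup>+x. ennreal ((cmod (X n x))\<^sup>2) \<partial>M) \<le> ennreal C" for n
      using C[of n] by (subst nn_integral_eq_integral[OF L2_square_integrable[OF X]]) (simp_all add: ennreal_leI)
  qed
  also have "\<dots> = ennreal C" by (simp add: Liminf_const)
  finally have le: "(\<integral>\<^sup>+x. ennreal ((cmod (Y x))\<^sup>2) \<partial>M) \<le> ennreal C" .
  then have int: "integrable M (\<lambda>x. (cmod (Y x))\<^sup>2)"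
    by (intro integrableI_nonneg) (auto intro: le_less_trans)
  then show "Y \<in> L2 M" using Ym by (simp add: L2_def)
  show "(LINT x|M. (cmod (Y x))\<^sup>2) \<le> C"
    using le C0 by (subst (asm) nn_integral_eq_integral[OF int]) simp_all
qed

section \<open>Sigma-finiteness of Haar measure and integration over the product\<close>

lemma haar_measure_sigma_finite:
  fixes \<mu> :: "'g::{topological_group_add,second_countable_topology,t2_space} measure"
  assumes lc: "locally_compact_space (euclidean :: 'g topology)" and haar: "haar_measure \<mu>"
  shows "sigma_finite_measure \<mu>"
proof
  have sets: "sets \<mu> = sets borel" and fin: "\<And>K. compact K \<Longrightarrow> emeasure \<mu> K < \<infinity>"
    using haar by (auto simp: haar_measure_def)
  define \<F> :: "'g set set" where "\<F> = {V. open V \<and> (\<exists>K. compact K \<and> V \<subseteq> K)}"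
  have "\<Union>\<F> = UNIV"
  proof (intro equalityI subsetI UNIV_I)
    fix x :: 'g
    obtain V K where "open V" "compact K" "x \<in> V" "V \<subseteq> K"
      using lc unfolding locally_compact_space_def by (metis UNIV_I compactin_euclidean_iff open_openin topspace_euclidean)
    then show "x \<in> \<Union>\<F>" by (auto simp: \<F>_def)
  qed
  \<comment> \<open>Second countability makes the cover countable (Lindelof); each member lies in a
    compact set and so has finite measure.\<close>
  moreover obtain \<F>' where "\<F>' \<subseteq> \<F>" "countable \<F>'" "\<Union>\<F>' = \<Union>\<F>"
    by (rule Lindelof[of \<F>]) (simp add: \<F>_def)
  ultimately have \<F>': "\<F>' \<subseteq> \<F>" "countable \<F>'" "\<Union>\<F>' = UNIV"
    by simp_all
  show "\<exists>A. countable A \<and> A \<subseteq> sets \<mu> \<and> \<Union>A = space \<mu> \<and> (\<forall>a\<in>A. emeasure \<mu> a \<noteq> \<infinity>)"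
  proof (intro exI conjI ballI)
    show "countable \<F>'" by fact
    show "\<F>' \<subseteq> sets \<mu>" using \<F>'(1) by (auto simp: sets \<F>_def)
    show "\<Union>\<F>' = space \<mu>" using \<F>'(3) sets_eq_imp_space_eq[OF sets] by simp
    fix V assume "V \<in> \<F>'"
    then obtain K where K: "compact K" "V \<subseteq> K" using \<F>'(1) by (auto simp: \<F>_def)
    have "emeasure \<mu> V \<le> emeasure \<mu> K"
      by (rule emeasure_mono[OF K(2)]) (simp add: sets borel_closed compact_imp_closed K(1))
    also have "\<dots> < \<infinity>" by (rule fin[OF K(1)])
    finally show "emeasure \<mu> V \<noteq> \<infinity>" by simp
  qed
qed

text \<open>Fubini for separated variables: it multiplies two orthogonality relations, one for each
  factor of G x G.\<close>

lemma (in sigma_finite_measure) has_bochner_integral_pair_mult: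
  fixes f h :: "'a \<Rightarrow> complex"
  assumes f: "has_bochner_integral M f a" and h: "has_bochner_integral M h b"
  shows "has_bochner_integral (M \<Otimes>\<^sub>M M) (\<lambda>x. f (fst x) * h (snd x)) (a * b)"
proof -
  interpret P: pair_sigma_finite M M ..
  have fi: "integrable M f" and hi: "integrable M h"
    and a: "integral\<^sup>L M f = a" and b: "integral\<^sup>L M h = b"
    using f h by (auto simp: has_bochner_integral_iff)
  have [measurable]: "f \<in> borel_measurable M" "h \<in> borel_measurable M"
    using fi hi by auto
  have int: "integrable (M \<Otimes>\<^sub>M M) (\<lambda>x. f (fst x) * h (snd x))"
    by (rule P.Fubini_integrable) (use fi hi in \<open>auto simp: norm_mult\<close>)
  have "integral\<^sup>L (M \<Otimes>\<^sub>M M) (\<lambda>x. f (fst x) * h (snd x)) = (LINT x|M. LINT y|M. f x * h y)"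
    using P.integral_fst'[OF int] by simp
  then show ?thesis using int by (simp add: has_bochner_integral_iff a b fi hi)
qed

section \<open>Quantization and dequantization\<close>

text \<open>The Duflo-Moore relations appear with constant 1, so no factor d^2 occurs in the sequel,
  and in the form \<open>has_bochner_integral\<close> they include integrability.
  \<open>sets_borel\<close> carries measurability of the matrix coefficients over to \<mu>.\<close>

locale normalized_rep = sigma_finite_measure \<mu>
  for \<mu> :: "'g::{topological_group_add,second_countable_topology,t2_space} measure" +
  fixes U :: "'g \<Rightarrow> 'h::complex_hilbert \<Rightarrow> 'h"
  assumes sets_borel: "sets \<mu> = sets borel"
    and unitary: "unitary_op (U g)"
    and borel_cinner: "(\<lambda>g. cinner \<phi> (U g \<psi>)) \<in> borel_measurable borel"
    and orthogonality: "has_bochner_integral \<mu>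
      (\<lambda>g. cinner \<phi>\<^sub>1 (U g \<psi>\<^sub>1) * cinner (U g \<psi>\<^sub>2) \<phi>\<^sub>2) (cinner \<phi>\<^sub>1 \<phi>\<^sub>2 * cinner \<psi>\<^sub>2 \<psi>\<^sub>1)"
begin

abbreviation "M \<equiv> \<mu> \<Otimes>\<^sub>M \<mu>"

lemma bounded_U: "bounded_clinear (U g)"
  by (rule unitary_bounded_clinear[OF unitary])

section \<open>Translates and dequantization at a point\<close>

lemma hilbert_schmidt_translate:
  assumes "hilbert_schmidt T" shows "hilbert_schmidt (translate U T g)"
  unfolding translate_def
  by (intro hilbert_schmidt_compose_right hilbert_schmidt_compose_left bounded_U
      bounded_clinear_cadjoint assms)

text \<open>An isometry on the left preserves the defining sum termwise; the factor on the right is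
  brought to the left by taking adjoints.\<close>

lemma hs_norm_translate:
  assumes T: "hilbert_schmidt T" shows "hs_norm (translate U T g) = hs_norm T"
proof -
  note T' = hilbert_schmidt_bounded[OF T]
  let ?V = "U (snd g)"
  have R: "hilbert_schmidt (T \<circ> cadjoint ?V)"
    by (intro hilbert_schmidt_compose_right bounded_clinear_cadjoint bounded_U T)
  have "hs_norm (translate U T g) = hs_norm (T \<circ> cadjoint ?V)"
    unfolding translate_def comp_assoc
    by (rule hs_norm_compose_left_isometry[OF bounded_U R unitary_norm[OF unitary]])
  also have "\<dots> = hs_norm (cadjoint (T \<circ> cadjoint ?V))"
    by (rule hs_norm_cadjoint[OF R, symmetric])
  also have "cadjoint (T \<circ> cadjoint ?V) = ?V \<circ> cadjoint T"
    by (simp add: cadjoint_compose T' bounded_clinear_cadjoint bounded_U cadjoint_cadjoint)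
  also have "hs_norm \<dots> = hs_norm (cadjoint T)"
    by (rule hs_norm_compose_left_isometry[OF bounded_U hilbert_schmidt_cadjoint[OF T]
          unitary_norm[OF unitary]])
  finally show ?thesis by (simp add: hs_norm_cadjoint T)
qed

lemma translate_add:
  "translate U (\<lambda>x. T x + S x) g = (\<lambda>x. translate U T g x + translate U S g x)"
  by (simp add: translate_def fun_eq_iff bounded_clinear_add bounded_U)

lemma translate_rank1: "translate U (rank1 t s) g = rank1 (U (fst g) t) (U (snd g) s)"
  by (simp add: translate_def fun_eq_iff rank1_def bounded_clinear_scaleC bounded_U
      cinner_cadjoint_right)

lemma dequantize_add:
  assumes "hilbert_schmidt T" "hilbert_schmidt A" "hilbert_schmidt B"
  shows "dequantize U T (\<lambda>x. A x + B x) g = dequantize U T A g + dequantize U T B g"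
  by (simp add: dequantize_def hs_inner_add_right hilbert_schmidt_translate assms)

lemma dequantize_add_window:
  assumes "hilbert_schmidt T" "hilbert_schmidt S" "hilbert_schmidt A"
  shows "dequantize U (\<lambda>x. T x + S x) A g = dequantize U T A g + dequantize U S A g"
  by (simp add: dequantize_def translate_add hs_inner_add_left hilbert_schmidt_translate assms)

lemma dequantize_scale:
  assumes "hilbert_schmidt T" "hilbert_schmidt A"
  shows "dequantize U T (\<lambda>x. c *\<^sub>C A x) g = c * dequantize U T A g"
  by (simp add: dequantize_def hs_inner_scale_right hilbert_schmidt_translate assms)

text \<open>A bound uniform in g; it gives pointwise convergence when T and A are approximated at
  the same time.\<close>

lemma cmod_dequantize_le:
  assumes "hilbert_schmidt T" "hilbert_schmidt A"
  shows "cmod (dequantize U T A g) \<le> hs_norm T * hs_norm A"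
  using cmod_hs_inner_le[OF hilbert_schmidt_translate assms(2), OF assms(1), of g]
  by (simp add: dequantize_def hs_norm_translate assms)

text \<open>Translation sends |t><s| to |U(g1) t><U(g2) s|, so rank one operators separate the two
  coordinates of g.\<close>

lemma dequantize_rank1:
  assumes B: "orthonormal_basis (B :: 'h set)"
  shows "dequantize U (rank1 t s) (rank1 a b) g = cinner (U (fst g) t) a * cinner b (U (snd g) s)"
  by (simp add: dequantize_def translate_rank1 hs_inner_rank1_right hilbert_schmidt_rank1[OF B])
    (simp add: rank1_def cinner_scaleC_left cinner_commute[of b] mult.commute)

section \<open>Square integrability and isometry of the dequantization map\<close>

lemma has_bochner_integral_dequantize_rank1:
  assumes B: "orthonormal_basis (B :: 'h set)"
  shows "has_bochner_integral M
    (\<lambda>g. cnj (dequantize U (rank1 t s) (rank1 a b) g) * dequantize U (rank1 t' s') (rank1 a' b') g)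
    (cinner a a' * cinner t' t * (cinner b' b * cinner s s'))"
proof -
  \<comment> \<open>The factors are grouped by coordinate. In the second coordinate the
    orthogonality relation is used with primed and unprimed vectors interchanged.\<close>
  have "cnj (dequantize U (rank1 t s) (rank1 a b) g) * dequantize U (rank1 t' s') (rank1 a' b') g =
     (cinner a (U (fst g) t) * cinner (U (fst g) t') a') *
     (cinner b' (U (snd g) s') * cinner (U (snd g) s) b)" for g
    by (simp add: dequantize_rank1[OF B] cinner_commute[symmetric] mult_ac)
  then show ?thesis
    using has_bochner_integral_pair_mult[OF orthogonality[of a t t' a'] orthogonality[of b' s' s b]]
    by simp
qed

lemma borel_dequantize_rank1:
  assumes B: "orthonormal_basis (B :: 'h set)"
  shows "dequantize U (rank1 t s) (rank1 a b) \<in> borel_measurable M"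
proof -
  have meas: "(\<lambda>g. cinner \<phi> (U g \<psi>)) \<in> borel_measurable \<mu>" for \<phi> \<psi>
    using borel_cinner measurable_cong_sets[OF sets_borel refl] by blast
  have "(\<lambda>g. cnj (cinner a (U g t))) \<in> borel_measurable \<mu>"
    using measurable_compose[OF meas borel_measurable_continuous_onI[of cnj]]
    by (simp add: continuous_on_cnj)
  then have "(\<lambda>g. cinner (U g t) a) \<in> borel_measurable \<mu>"
    by (simp only: cinner_commute[symmetric])
  from measurable_compose[OF measurable_fst this] measurable_compose[OF measurable_snd meas]
  have "(\<lambda>g. cinner (U (fst g) t) a * cinner b (U (snd g) s)) \<in> borel_measurable M"
    by (intro borel_measurable_times)
  then show ?thesis
    by (subst measurable_cong[where g="\<lambda>g. cinner (U (fst g) t) a * cinner b (U (snd g) s)"])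
      (simp_all add: dequantize_rank1[OF B])
qed

lemma dequantize_truncate_op:
  assumes B: "orthonormal_basis (B :: 'h set)" and S: "finite S"
  shows "dequantize U (truncate_op S T) (truncate_op S A) g =
    (\<Sum>(e, f)\<in>S \<times> S. dequantize U (rank1 (T e) e) (rank1 (A f) f) g)"
proof -
  note tr = hilbert_schmidt_truncate[OF B S] and r1 = hilbert_schmidt_rank1[OF B]
  have "dequantize U (truncate_op S T) (truncate_op S A) g =
      (\<Sum>e\<in>S. dequantize U (rank1 (T e) e) (truncate_op S A) g)"
    by (rule hs_additive_truncate[where F="\<lambda>T. dequantize U T (truncate_op S A) g", OF _ B S])
      (rule dequantize_add_window[OF _ _ tr])
  also have "\<dots> = (\<Sum>e\<in>S. \<Sum>f\<in>S. dequantize U (rank1 (T e) e) (rank1 (A f) f) g)"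
    by (intro sum.cong refl
        hs_additive_truncate[where F="\<lambda>A. dequantize U T' A g" for T', OF _ B S])
      (rule dequantize_add[OF r1])
  finally show ?thesis by (simp add: sum.cartesian_product)
qed

text \<open>The squared modulus expands into a double sum over S x S. Orthonormality of S kills the
  off-diagonal terms after integration, and what remains is the product of the partial sums of the
  two squared norms.\<close>

lemma dequantize_truncate_op_L2:
  assumes B: "orthonormal_basis (B :: 'h set)" and S: "finite S" "S \<subseteq> B"
    and T: "hilbert_schmidt T" and A: "hilbert_schmidt A"
  shows "dequantize U (truncate_op S T) (truncate_op S A) \<in> L2 M"
    and "(LINT g|M. (cmod (dequantize U (truncate_op S T) (truncate_op S A) g))\<^sup>2)
      \<le> (hs_norm T * hs_norm A)\<^sup>2"
proof -
  define D where "D = dequantize U (truncate_op S T) (truncate_op S A)"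
  define c where "c p = dequantize U (rank1 (T (fst p)) (fst p)) (rank1 (A (snd p)) (snd p))" for p
  have D: "D = (\<lambda>g. \<Sum>p\<in>S \<times> S. c p g)"
    by (simp add: D_def c_def fun_eq_iff dequantize_truncate_op[OF B S(1)] case_prod_unfold)
  have Dm: "D \<in> borel_measurable M"
    unfolding D c_def by (intro borel_measurable_sum borel_dequantize_rank1[OF B])
  \<comment> \<open>w p q is the value that the orthogonality relations give to the integral of
    \<open>cnj (c p g) * c q g\<close>.\<close>
  define w where "w p q = cinner (A (snd p)) (A (snd q)) * cinner (T (fst q)) (T (fst p)) *
      (cinner (snd q) (snd p) * cinner (fst p) (fst q))" for p q
  have on: "cinner e f = (if e = f then 1 else 0)" if "e \<in> S" "f \<in> S" for e f
  proof -
    have "e \<in> B" "f \<in> B" using S that by auto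
    then show ?thesis using B by (simp add: orthonormal_basis_def)
  qed
  have diag: "(\<Sum>q\<in>S \<times> S. w p q) = complex_of_real ((norm (T (fst p)))\<^sup>2 * (norm (A (snd p)))\<^sup>2)"
    if p: "p \<in> S \<times> S" for p
  proof -
    have "w p q = (if q = p then complex_of_real ((norm (T (fst p)))\<^sup>2 * (norm (A (snd p)))\<^sup>2) else 0)"
      if q: "q \<in> S \<times> S" for q
    proof -
      have 1: "cinner (snd q) (snd p) = (if snd q = snd p then 1 else 0)"
        "cinner (fst p) (fst q) = (if fst p = fst q then 1 else 0)"
        by (rule on; use p q in \<open>simp add: mem_Times_iff\<close>)+
      show ?thesis
      proof (cases "q = p")
        case True
        have "w p p = cinner (A (snd p)) (A (snd p)) * cinner (T (fst p)) (T (fst p))"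
          using 1 by (simp add: w_def True)
        then show ?thesis by (simp add: True cinner_self mult.commute)
      next
        case False
        then have "snd q \<noteq> snd p \<or> fst p \<noteq> fst q" by (auto simp: prod_eq_iff)
        then show ?thesis
          using False unfolding w_def 1 by auto
      qed
    qed
    then have "(\<Sum>q\<in>S \<times> S. w p q) = (\<Sum>q\<in>S \<times> S. if q = p then
        complex_of_real ((norm (T (fst p)))\<^sup>2 * (norm (A (snd p)))\<^sup>2) else 0)"
      by (intro sum.cong refl)
    also have "\<dots> = complex_of_real ((norm (T (fst p)))\<^sup>2 * (norm (A (snd p)))\<^sup>2)"
      using p S(1) by (subst sum.delta) simp_all
    finally show ?thesis .
  qed
  have "has_bochner_integral M (\<lambda>g. \<Sum>p\<in>S \<times> S. \<Sum>q\<in>S \<times> S. cnj (c p g) * c q g)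
      (\<Sum>p\<in>S \<times> S. \<Sum>q\<in>S \<times> S. w p q)"
    unfolding c_def w_def
    by (intro has_bochner_integral_sum has_bochner_integral_dequantize_rank1[OF B])
  moreover have "(\<Sum>p\<in>S \<times> S. \<Sum>q\<in>S \<times> S. cnj (c p g) * c q g) = complex_of_real ((cmod (D g))\<^sup>2)" for g
  proof -
    have "(\<Sum>p\<in>S \<times> S. \<Sum>q\<in>S \<times> S. cnj (c p g) * c q g) = cnj (D g) * D g"
      by (simp add: D sum_product)
    then show ?thesis by (simp only: complex_norm_square mult.commute)
  qed
  moreover have "(\<Sum>p\<in>S \<times> S. \<Sum>q\<in>S \<times> S. w p q) =
      complex_of_real ((\<Sum>e\<in>S. (norm (T e))\<^sup>2) * (\<Sum>f\<in>S. (norm (A f))\<^sup>2))"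
  proof -
    have "(\<Sum>p\<in>S \<times> S. \<Sum>q\<in>S \<times> S. w p q) =
        (\<Sum>p\<in>S \<times> S. complex_of_real ((norm (T (fst p)))\<^sup>2 * (norm (A (snd p)))\<^sup>2))"
      by (intro sum.cong refl diag)
    also have "\<dots> = complex_of_real (\<Sum>p\<in>S \<times> S. (norm (T (fst p)))\<^sup>2 * (norm (A (snd p)))\<^sup>2)"
      by (simp only: of_real_sum)
    also have "(\<Sum>p\<in>S \<times> S. (norm (T (fst p)))\<^sup>2 * (norm (A (snd p)))\<^sup>2) =
        (\<Sum>e\<in>S. (norm (T e))\<^sup>2) * (\<Sum>f\<in>S. (norm (A f))\<^sup>2)"
      by (simp add: sum_product sum.cartesian_product case_prod_unfold)
    finally show ?thesis .
  qed
  ultimately have "has_bochner_integral M (\<lambda>g. complex_of_real ((cmod (D g))\<^sup>2))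
      (complex_of_real ((\<Sum>e\<in>S. (norm (T e))\<^sup>2) * (\<Sum>f\<in>S. (norm (A f))\<^sup>2)))"
    by (simp only:)
  from has_bochner_integral_Re[OF this]
  have int: "has_bochner_integral M (\<lambda>g. (cmod (D g))\<^sup>2)
      ((\<Sum>e\<in>S. (norm (T e))\<^sup>2) * (\<Sum>f\<in>S. (norm (A f))\<^sup>2))"
    by (simp only: Re_complex_of_real)
  have le: "(\<Sum>e\<in>S. (norm (X e))\<^sup>2) \<le> (hs_norm X)\<^sup>2" if "hilbert_schmidt X" for X :: "'h \<Rightarrow> 'h"
    using hs_norm_has_sum[OF that B] S by (intro finite_sum_le_has_sum) auto
  show "dequantize U (truncate_op S T) (truncate_op S A) \<in> L2 M"
    unfolding D_def[symmetric] using Dm int by (simp add: L2_def has_bochner_integral_iff)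
  have "(LINT g|M. (cmod (D g))\<^sup>2) = (\<Sum>e\<in>S. (norm (T e))\<^sup>2) * (\<Sum>f\<in>S. (norm (A f))\<^sup>2)"
    using int by (simp add: has_bochner_integral_iff)
  also have "\<dots> \<le> (hs_norm T)\<^sup>2 * (hs_norm A)\<^sup>2"
    by (intro mult_mono le T A sum_nonneg) auto
  finally show "(LINT g|M. (cmod (dequantize U (truncate_op S T) (truncate_op S A) g))\<^sup>2)
      \<le> (hs_norm T * hs_norm A)\<^sup>2"
    unfolding D_def[symmetric] by (simp add: power_mult_distrib)
qed

text \<open>The bound for truncations does not depend on S, and the truncated functions converge at
  every g: these are the two inputs of \<open>L2_fatou\<close>.\<close>

lemma dequantize_L2:
  assumes T: "hilbert_schmidt T" and A: "hilbert_schmidt A"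
  shows "dequantize U T A \<in> L2 M"
    and "(LINT g|M. (cmod (dequantize U T A g))\<^sup>2) \<le> (hs_norm T * hs_norm A)\<^sup>2"
proof -
  let ?B = "some_onb :: 'h set"
  note B = hilbert_schmidt_onb[OF T]
  define d where "d X S = hs_norm (\<lambda>x. X x - truncate_op S X x)" for X :: "'h \<Rightarrow> 'h" and S
  have d_nonneg: "d X S \<ge> 0" if "hilbert_schmidt X" "finite S" for X S
    unfolding d_def
    by (intro hs_norm_nonneg hilbert_schmidt_minus hilbert_schmidt_truncate[OF B] that)
  \<comment> \<open>Fatou needs a sequence, whereas truncations form a net over finite subsets. Two
    eventual properties hold jointly, so one S n serves both operators.\<close>
  have "\<exists>S. finite S \<and> S \<subseteq> ?B \<and> d T S < 1 / real (Suc n) \<and> d A S < 1 / real (Suc n)" for n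
  proof -
    have "\<forall>\<^sub>F S in finite_subsets_at_top ?B. d X S < 1 / real (Suc n)" if "hilbert_schmidt X" for X
      unfolding d_def
      by (rule order_tendstoD(2)[OF tendsto_hs_norm_truncate[OF that B]]) simp
    from eventually_conj[OF this[OF T] this[OF A]]
    show ?thesis
      unfolding eventually_finite_subsets_at_top by blast
  qed
  then obtain S where S: "\<And>n. finite (S n)" "\<And>n. S n \<subseteq> ?B"
    and dT: "\<And>n. d T (S n) < 1 / real (Suc n)" and dA: "\<And>n. d A (S n) < 1 / real (Suc n)"
    by metis
  have d0: "(\<lambda>n. d X (S n)) \<longlonglongrightarrow> 0"
    if "hilbert_schmidt X" "\<And>n. d X (S n) < 1 / real (Suc n)" for X
  proof (rule tendsto_sandwich[OF _ _ tendsto_const LIMSEQ_Suc[OF lim_1_over_n]])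
    show "\<forall>\<^sub>F n in sequentially. 0 \<le> d X (S n)"
      using d_nonneg[OF that(1) S(1)] by simp
    show "\<forall>\<^sub>F n in sequentially. d X (S n) \<le> 1 / real (Suc n)"
      using that(2) by (intro always_eventually allI less_imp_le)
  qed
  define D where "D n = dequantize U (truncate_op (S n) T) (truncate_op (S n) A)" for n
  have lim: "(\<lambda>n. D n g) \<longlonglongrightarrow> dequantize U T A g" for g
  proof (rule LIM_zero_cancel, rule Lim_null_comparison)
    show "(\<lambda>n. d T (S n) * hs_norm A + (hs_norm T * d A (S n) + d T (S n) * d A (S n))) \<longlonglongrightarrow> 0"
    proof -
      note dT0 = d0[OF T dT] and dA0 = d0[OF A dA]
      show ?thesis
        by (intro tendsto_add_zero tendsto_mult_zero[OF dT0 dA0] tendsto_mult_left_zero[OF dT0]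
            tendsto_mult_right_zero[OF dA0])
    qed
    show "\<forall>\<^sub>F n in sequentially. norm (D n g - dequantize U T A g)
        \<le> d T (S n) * hs_norm A + (hs_norm T * d A (S n) + d T (S n) * d A (S n))"
    proof (rule always_eventually, rule allI)
      fix n
      note trT = hilbert_schmidt_truncate[OF B S(1), of n T]
        and trA = hilbert_schmidt_truncate[OF B S(1), of n A]
      note dT' = hilbert_schmidt_minus[OF T trT] and dA' = hilbert_schmidt_minus[OF A trA]
      let ?dT = "\<lambda>x. T x - truncate_op (S n) T x" and ?dA = "\<lambda>x. A x - truncate_op (S n) A x"
      have splitT: "dequantize U T X g = dequantize U ?dT X g + dequantize U (truncate_op (S n) T) X g"
        if "hilbert_schmidt X" for X
        using dequantize_add_window[OF dT' trT that] by simp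
      have splitA: "dequantize U X A g = dequantize U X ?dA g + dequantize U X (truncate_op (S n) A) g"
        if "hilbert_schmidt X" for X
        using dequantize_add[OF that dA' trA] by simp
      \<comment> \<open>Arranged so that no truncated operator is left: the estimate involves only
        \<open>hs_norm T\<close>, \<open>hs_norm A\<close> and the two small distances.\<close>
      have "dequantize U T A g - D n g =
          dequantize U ?dT A g + (dequantize U T ?dA g - dequantize U ?dT ?dA g)"
        using splitT[OF A] splitA[OF trT] splitT[OF dA'] by (simp add: D_def)
      then have "norm (D n g - dequantize U T A g) =
          norm (dequantize U ?dT A g + (dequantize U T ?dA g - dequantize U ?dT ?dA g))"
        by (metis norm_minus_commute)
      also have "\<dots> \<le> norm (dequantize U ?dT A g) +
          (norm (dequantize U T ?dA g) + norm (dequantize U ?dT ?dA g))"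
        by (intro norm_triangle_le add_left_mono norm_triangle_ineq4)
      also have "\<dots> \<le> d T (S n) * hs_norm A + (hs_norm T * d A (S n) + d T (S n) * d A (S n))"
        unfolding d_def by (intro add_mono cmod_dequantize_le T A dT' dA')
      finally show "norm (D n g - dequantize U T A g)
        \<le> d T (S n) * hs_norm A + (hs_norm T * d A (S n) + d T (S n) * d A (S n))" .
    qed
  qed
  have "D n \<in> L2 M" "(LINT g|M. (cmod (D n g))\<^sup>2) \<le> (hs_norm T * hs_norm A)\<^sup>2" for n
    unfolding D_def by (rule dequantize_truncate_op_L2[OF B S T A])+
  from L2_fatou[of D, OF this(1) lim this(2)]
  show "dequantize U T A \<in> L2 M"
    "(LINT g|M. (cmod (dequantize U T A g))\<^sup>2) \<le> (hs_norm T * hs_norm A)\<^sup>2"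
    by blast+
qed

text \<open>The factor in front of \<open>hs_norm A\<close> is the constant K for
  \<open>hs_riesz\<close>.\<close>

lemma L2_inner_dequantize_le:
  assumes T: "hilbert_schmidt T" and A: "hilbert_schmidt A" and \<Phi>: "\<Phi> \<in> L2 M"
  shows "cmod (L2_inner M (dequantize U T A) \<Phi>)
    \<le> hs_norm T * sqrt (LINT g|M. (cmod (\<Phi> g))\<^sup>2) * hs_norm A"
proof -
  have "cmod (L2_inner M (dequantize U T A) \<Phi>) \<le>
      sqrt (LINT g|M. (cmod (dequantize U T A g))\<^sup>2) * sqrt (LINT g|M. (cmod (\<Phi> g))\<^sup>2)"
    by (rule L2_inner_cauchy_schwarz[OF dequantize_L2(1)[OF T A] \<Phi>])
  also have "\<dots> \<le> (hs_norm T * hs_norm A) * sqrt (LINT g|M. (cmod (\<Phi> g))\<^sup>2)"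
    by (intro mult_right_mono real_le_lsqrt dequantize_L2 T A mult_nonneg_nonneg hs_norm_nonneg)
      (auto intro: integral_nonneg_AE)
  finally show ?thesis by (simp only: mult_ac)
qed

lemma L2_inner_dequantize2_le:
  assumes T: "hilbert_schmidt T" and S: "hilbert_schmidt S"
    and A: "hilbert_schmidt A" and B: "hilbert_schmidt B"
  shows "cmod (L2_inner M (dequantize U T B) (dequantize U S A))
    \<le> hs_norm T * hs_norm B * hs_norm S * hs_norm A"
proof -
  have "cmod (L2_inner M (dequantize U T B) (dequantize U S A)) \<le>
      hs_norm T * sqrt (LINT g|M. (cmod (dequantize U S A g))\<^sup>2) * hs_norm B"
    by (rule L2_inner_dequantize_le[OF T B dequantize_L2(1)[OF S A]])
  also have "\<dots> \<le> hs_norm T * (hs_norm S * hs_norm A) * hs_norm B"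
    by (intro mult_right_mono mult_left_mono real_le_lsqrt dequantize_L2 S A T B
        mult_nonneg_nonneg hs_norm_nonneg)
  finally show ?thesis by (simp only: mult_ac)
qed

text \<open>By the inequality in \<open>dequantize_L2\<close> both sides are bounded in each of the
  four operators, so equality extends from rank one operators one slot at a time: A, then S, B and
  T. The order of arguments in \<open>hs_inner S T\<close> reflects that \<open>dequantize\<close>
  is antilinear in its window.\<close>

lemma L2_inner_dequantize:
  assumes T: "hilbert_schmidt T" and S: "hilbert_schmidt S"
    and B: "hilbert_schmidt B" and A: "hilbert_schmidt A"
  shows "L2_inner M (dequantize U T B) (dequantize U S A) = hs_inner B A * hs_inner S T"
proof -
  note onb = hilbert_schmidt_onb[OF T]
  note r1 = hilbert_schmidt_rank1[OF onb]
  have rhs_le: "cmod (hs_inner B A * hs_inner S T) \<le> hs_norm T * hs_norm B * hs_norm S * hs_norm A"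
    if "hilbert_schmidt T" "hilbert_schmidt S" "hilbert_schmidt B" "hilbert_schmidt A"
    for T S B A :: "'h \<Rightarrow> 'h"
  proof -
    have "cmod (hs_inner B A * hs_inner S T) \<le> (hs_norm B * hs_norm A) * (hs_norm S * hs_norm T)"
      unfolding norm_mult
      by (intro mult_mono cmod_hs_inner_le that mult_nonneg_nonneg hs_norm_nonneg norm_ge_zero)
    then show ?thesis by (simp only: mult_ac)
  qed
  note L2 = dequantize_L2(1)
  note bounds = L2_inner_dequantize2_le rhs_le
  have 1: "L2_inner M (dequantize U (rank1 t s) (rank1 a b)) (dequantize U (rank1 t' s') (rank1 a' b')) =
      hs_inner (rank1 a b) (rank1 a' b') * hs_inner (rank1 t' s') (rank1 t s)" for t s a b t' s' a' b'
    using has_bochner_integral_dequantize_rank1[OF onb, of t s a b t' s' a' b']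
    by (simp add: L2_inner_def has_bochner_integral_iff hs_inner_rank1_right[OF r1])
      (simp add: rank1_def cinner_scaleC_left cinner_commute[symmetric] mult_ac)
  have 2: "L2_inner M (dequantize U (rank1 t s) (rank1 a b)) (dequantize U (rank1 t' s') A) =
      hs_inner (rank1 a b) A * hs_inner (rank1 t' s') (rank1 t s)"
    if A: "hilbert_schmidt A" for t s a b t' s' A
  proof (rule hs_functional_eqI[OF _ _ _ _ _ A])
    show "cmod (L2_inner M (dequantize U (rank1 t s) (rank1 a b)) (dequantize U (rank1 t' s') X)) \<le>
        hs_norm (rank1 t s) * hs_norm (rank1 a b) * hs_norm (rank1 t' s') * hs_norm X"
      if "hilbert_schmidt X" for X by (rule bounds(1)[OF r1 r1 that r1])
    show "cmod (hs_inner (rank1 a b) X * hs_inner (rank1 t' s') (rank1 t s)) \<le>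
        hs_norm (rank1 t s) * hs_norm (rank1 a b) * hs_norm (rank1 t' s') * hs_norm X"
      if "hilbert_schmidt X" for X by (rule bounds(2)[OF r1 r1 r1 that])
  qed (simp_all add: dequantize_add L2_inner_add_right L2 r1 hs_inner_add_right distrib_right 1)
  have 3: "L2_inner M (dequantize U (rank1 t s) (rank1 a b)) (dequantize U S A) =
      hs_inner (rank1 a b) A * hs_inner S (rank1 t s)"
    if A: "hilbert_schmidt A" and S: "hilbert_schmidt S" for t s a b S A
  proof (rule hs_functional_eqI[OF _ _ _ _ _ S])
    show "cmod (L2_inner M (dequantize U (rank1 t s) (rank1 a b)) (dequantize U X A)) \<le>
        hs_norm (rank1 t s) * hs_norm (rank1 a b) * hs_norm A * hs_norm X"
      if "hilbert_schmidt X" for X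
        by (rule order_trans[OF bounds(1)[OF r1 that A r1]]) (simp only: mult_ac order_refl)
    show "cmod (hs_inner (rank1 a b) A * hs_inner X (rank1 t s)) \<le>
        hs_norm (rank1 t s) * hs_norm (rank1 a b) * hs_norm A * hs_norm X"
      if "hilbert_schmidt X" for X
        by (rule order_trans[OF bounds(2)[OF r1 that r1 A]]) (simp only: mult_ac order_refl)
  qed (simp_all add: dequantize_add_window L2_inner_add_right L2 r1 A hs_inner_add_left
      distrib_left 2)
  have 4: "L2_inner M (dequantize U (rank1 t s) B) (dequantize U S A) =
      hs_inner B A * hs_inner S (rank1 t s)"
    if A: "hilbert_schmidt A" and S: "hilbert_schmidt S" and B: "hilbert_schmidt B" for t s B S A
  proof (rule hs_functional_eqI[OF _ _ _ _ _ B])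
    show "cmod (L2_inner M (dequantize U (rank1 t s) X) (dequantize U S A)) \<le>
        hs_norm (rank1 t s) * hs_norm S * hs_norm A * hs_norm X"
      if "hilbert_schmidt X" for X
        by (rule order_trans[OF bounds(1)[OF r1 S A that]]) (simp only: mult_ac order_refl)
    show "cmod (hs_inner X A * hs_inner S (rank1 t s)) \<le>
        hs_norm (rank1 t s) * hs_norm S * hs_norm A * hs_norm X"
      if "hilbert_schmidt X" for X
        by (rule order_trans[OF bounds(2)[OF r1 S that A]]) (simp only: mult_ac order_refl)
  qed (simp_all add: dequantize_add L2_inner_add_left L2 r1 A S hs_inner_add_left
      distrib_right 3)
  show ?thesis
  proof (rule hs_functional_eqI[OF _ _ _ _ _ T])
    show "cmod (L2_inner M (dequantize U X B) (dequantize U S A)) \<le>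
        hs_norm B * hs_norm S * hs_norm A * hs_norm X"
      if "hilbert_schmidt X" for X
        by (rule order_trans[OF bounds(1)[OF that S A B]]) (simp only: mult_ac order_refl)
    show "cmod (hs_inner B A * hs_inner S X) \<le> hs_norm B * hs_norm S * hs_norm A * hs_norm X"
      if "hilbert_schmidt X" for X
        by (rule order_trans[OF bounds(2)[OF that S B A]]) (simp only: mult_ac order_refl)
  qed (simp_all add: dequantize_add_window L2_inner_add_left L2 A B S hs_inner_add_right
      distrib_left 4)
qed

section \<open>The quantization map and the star product kernel\<close>

lemma quantize_eqI:
  assumes Q: "hilbert_schmidt Q"
    and eq: "\<And>B. hilbert_schmidt B \<Longrightarrow> hs_inner B Q = L2_inner M (dequantize U T B) \<Phi>"
  shows "quantize \<mu> U T \<Phi> = Q"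
  unfolding quantize_def
proof (rule the_equality)
  fix A assume "hilbert_schmidt A \<and>
    (\<forall>B. hilbert_schmidt B \<longrightarrow> hs_inner B A = L2_inner M (dequantize U T B) \<Phi>)"
  then show "A = Q" by (intro hs_eqI) (simp_all add: Q eq)
qed (simp add: Q eq)

text \<open>Existence for the definite description: the pairing with \<Phi> is antilinear and
  bounded in B, so \<open>hs_riesz\<close> applies.\<close>

lemma
  assumes T: "hilbert_schmidt T" and \<Phi>: "\<Phi> \<in> L2 M"
  shows hilbert_schmidt_quantize: "hilbert_schmidt (quantize \<mu> U T \<Phi>)"
    and hs_inner_quantize: "hilbert_schmidt B \<Longrightarrow>
      hs_inner B (quantize \<mu> U T \<Phi>) = L2_inner M (dequantize U T B) \<Phi>"
proof -
  have "\<exists>Q. hilbert_schmidt Q \<and>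
      (\<forall>B. hilbert_schmidt B \<longrightarrow> hs_inner B Q = L2_inner M (dequantize U T B) \<Phi>)"
  proof (rule hs_riesz[OF _ _ L2_inner_dequantize_le[OF T _ \<Phi>] hilbert_schmidt_onb[OF T]])
    fix A :: "'h \<Rightarrow> 'h" assume A: "hilbert_schmidt A"
    show "L2_inner M (dequantize U T (\<lambda>x. c *\<^sub>C A x)) \<Phi> = cnj c * L2_inner M (dequantize U T A) \<Phi>"
      for c
      unfolding L2_inner_def by (simp add: dequantize_scale T A mult.assoc)
    show "L2_inner M (dequantize U T (\<lambda>x. A x + B x)) \<Phi> =
        L2_inner M (dequantize U T A) \<Phi> + L2_inner M (dequantize U T B) \<Phi>"
      if "hilbert_schmidt B" for B
    proof -
      have "dequantize U T (\<lambda>x. A x + B x) = (\<lambda>g. dequantize U T A g + dequantize U T B g)"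
        by (simp add: fun_eq_iff dequantize_add T A that)
      then show ?thesis by (simp add: T A that L2_inner_add_left dequantize_L2(1) \<Phi>)
    qed
  qed
  then obtain Q where Q: "hilbert_schmidt Q"
    "\<And>B. hilbert_schmidt B \<Longrightarrow> hs_inner B Q = L2_inner M (dequantize U T B) \<Phi>" by blast
  then have "quantize \<mu> U T \<Phi> = Q" by (rule quantize_eqI)
  then show "hilbert_schmidt (quantize \<mu> U T \<Phi>)"
    "hilbert_schmidt B \<Longrightarrow> hs_inner B (quantize \<mu> U T \<Phi>) = L2_inner M (dequantize U T B) \<Phi>"
    using Q by simp_all
qed

text \<open>The pairing of the two dequantizations is \<open>hs_inner B A * hs_inner T T\<close>,
  and the normalisation of T makes the last factor 1.\<close>

lemma quantize_dequantize:
  assumes T: "hilbert_schmidt T" "hs_norm T = 1" and A: "hilbert_schmidt A"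
  shows "quantize \<mu> U T (dequantize U T A) = A"
  by (rule quantize_eqI[OF A]) (simp add: L2_inner_dequantize T A hs_inner_self)

text \<open>The first two factors of the kernel form the adjoint of
  \<open>cadjoint (translate U T g') \<circ> translate U T g\<close>, so the trace is an
  \<open>hs_inner\<close> with the translate at g''. Exchanging its arguments produces the
  conjugate.\<close>

lemma star_kernel_eq:
  assumes T: "hilbert_schmidt T"
  shows "star_kernel U T g g' g'' =
    cnj (dequantize U T (cadjoint (translate U T g') \<circ> translate U T g) g'')"
proof -
  note t = hilbert_schmidt_translate[OF T]
  note tb = hilbert_schmidt_bounded[OF t]
  have X: "hilbert_schmidt (cadjoint (translate U T g') \<circ> translate U T g)"
    by (intro hilbert_schmidt_compose_left bounded_clinear_cadjoint tb t)
  have "cadjoint (cadjoint (translate U T g') \<circ> translate U T g) =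
      cadjoint (translate U T g) \<circ> translate U T g'"
    by (simp add: cadjoint_compose bounded_clinear_cadjoint tb cadjoint_cadjoint)
  then have "star_kernel U T g g' g'' =
      hs_inner (cadjoint (translate U T g') \<circ> translate U T g) (translate U T g'')"
    by (simp add: star_kernel_def hs_inner_def)
  then show ?thesis
    by (simp add: dequantize_def hs_inner_commute[OF X t])
qed

text \<open>For fixed g the two integrations are successive pairings of square integrable functions.
  As \<open>dequantize\<close> is defined at every point, no null set has to be removed.\<close>

lemma star_kernel_integral:
  assumes T: "hilbert_schmidt T" and \<Phi>\<^sub>1: "\<Phi>\<^sub>1 \<in> L2 M" and \<Phi>\<^sub>2: "\<Phi>\<^sub>2 \<in> L2 M"
  shows "iterated_integrable M (\<lambda>g' g''. star_kernel U T g g' g'' * \<Phi>\<^sub>1 g' * \<Phi>\<^sub>2 g'')"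
    and "star_product \<mu> U T \<Phi>\<^sub>1 \<Phi>\<^sub>2 g =
      (LINT g'|M. LINT g''|M. star_kernel U T g g' g'' * \<Phi>\<^sub>1 g' * \<Phi>\<^sub>2 g'')"
proof -
  define Q\<^sub>1 Q\<^sub>2 where "Q\<^sub>1 = quantize \<mu> U T \<Phi>\<^sub>1" and "Q\<^sub>2 = quantize \<mu> U T \<Phi>\<^sub>2"
  have Q\<^sub>1: "hilbert_schmidt Q\<^sub>1" and Q\<^sub>2: "hilbert_schmidt Q\<^sub>2"
    unfolding Q\<^sub>1_def Q\<^sub>2_def by (intro hilbert_schmidt_quantize T \<Phi>\<^sub>1 \<Phi>\<^sub>2)+
  note Q\<^sub>2b = hilbert_schmidt_bounded[OF Q\<^sub>2]
  define V where "V = translate U T"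
  have V: "hilbert_schmidt (V h)" for h
    unfolding V_def by (rule hilbert_schmidt_translate[OF T])
  note Vb = hilbert_schmidt_bounded[OF V]
  have X: "hilbert_schmidt (cadjoint (V g') \<circ> V g)" for g'
    by (intro hilbert_schmidt_compose_left bounded_clinear_cadjoint Vb V)
  have Y: "hilbert_schmidt (V g \<circ> cadjoint Q\<^sub>2)"
    by (intro hilbert_schmidt_compose_right bounded_clinear_cadjoint Q\<^sub>2b V)
  have integrand: "star_kernel U T g g' g'' * \<Phi>\<^sub>1 g' * \<Phi>\<^sub>2 g'' =
      \<Phi>\<^sub>1 g' * (cnj (dequantize U T (cadjoint (V g') \<circ> V g) g'') * \<Phi>\<^sub>2 g'')" for g' g''
    by (simp add: star_kernel_eq[OF T] V_def mult_ac)
  have inner_int: "integrable M (\<lambda>g''. star_kernel U T g g' g'' * \<Phi>\<^sub>1 g' * \<Phi>\<^sub>2 g'')" for g'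
    unfolding integrand by (intro integrable_mult_right L2_mult_integrable dequantize_L2(1) T X \<Phi>\<^sub>2)
  have inner_eq: "(LINT g''|M. star_kernel U T g g' g'' * \<Phi>\<^sub>1 g' * \<Phi>\<^sub>2 g'') =
      cnj (dequantize U T (V g \<circ> cadjoint Q\<^sub>2) g') * \<Phi>\<^sub>1 g'" for g'
  proof -
    have "(LINT g''|M. star_kernel U T g g' g'' * \<Phi>\<^sub>1 g' * \<Phi>\<^sub>2 g'') =
        \<Phi>\<^sub>1 g' * L2_inner M (dequantize U T (cadjoint (V g') \<circ> V g)) \<Phi>\<^sub>2"
      unfolding integrand L2_inner_def by (rule integral_mult_right_zero)
    also have "L2_inner M (dequantize U T (cadjoint (V g') \<circ> V g)) \<Phi>\<^sub>2 =
        hs_inner (cadjoint (V g') \<circ> V g) Q\<^sub>2"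
      unfolding Q\<^sub>2_def by (rule hs_inner_quantize[OF T \<Phi>\<^sub>2 X, symmetric])
    also have "\<dots> = hs_inner (V g) (V g' \<circ> Q\<^sub>2)"
      by (rule hs_inner_compose_left[OF Vb V Q\<^sub>2])
    also have "\<dots> = hs_inner (V g \<circ> cadjoint Q\<^sub>2) (V g')"
      by (rule hs_inner_compose_right[OF Q\<^sub>2b V V, symmetric])
    also have "\<dots> = cnj (dequantize U T (V g \<circ> cadjoint Q\<^sub>2) g')"
      unfolding dequantize_def V_def[symmetric] by (rule hs_inner_commute[OF Y V])
    finally show ?thesis by (simp only: mult.commute)
  qed
  \<comment> \<open>The inner integral has become a square integrable function of g' times
    \<open>\<Phi>\<^sub>1 g'\<close>, so the outer integral exists for the same reason as the inner
    one.\<close>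
  show "iterated_integrable M (\<lambda>g' g''. star_kernel U T g g' g'' * \<Phi>\<^sub>1 g' * \<Phi>\<^sub>2 g'')"
    unfolding iterated_integrable_def inner_eq
    by (intro conjI AE_I2 inner_int L2_mult_integrable dequantize_L2(1) T Y \<Phi>\<^sub>1)
  have "(LINT g'|M. LINT g''|M. star_kernel U T g g' g'' * \<Phi>\<^sub>1 g' * \<Phi>\<^sub>2 g'') =
      L2_inner M (dequantize U T (V g \<circ> cadjoint Q\<^sub>2)) \<Phi>\<^sub>1"
    unfolding inner_eq L2_inner_def ..
  also have "\<dots> = hs_inner (V g \<circ> cadjoint Q\<^sub>2) Q\<^sub>1"
    unfolding Q\<^sub>1_def by (rule hs_inner_quantize[OF T \<Phi>\<^sub>1 Y, symmetric])
  also have "\<dots> = hs_inner (V g) (Q\<^sub>1 \<circ> Q\<^sub>2)"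
    by (rule hs_inner_compose_right[OF Q\<^sub>2b V Q\<^sub>1])
  finally show "star_product \<mu> U T \<Phi>\<^sub>1 \<Phi>\<^sub>2 g =
      (LINT g'|M. LINT g''|M. star_kernel U T g g' g'' * \<Phi>\<^sub>1 g' * \<Phi>\<^sub>2 g'')"
    by (simp only: star_product_def dequantize_def V_def Q\<^sub>1_def Q\<^sub>2_def)
qed

end

theorem mainTheorem3:
  fixes U :: "'g::{topological_group_add,second_countable_topology,t2_space} \<Rightarrow> 'h::complex_hilbert \<Rightarrow> 'h"
    and \<mu> :: "'g measure"
    and T :: "'h \<Rightarrow> 'h"
  assumes "locally_compact_space (euclidean :: 'g topology)"
    and "unimodular TYPE('g)"
    and "separable_space (euclidean :: 'h topology)"
    and "haar_measure \<mu>"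
    and "square_integrable_rep \<mu> U"
    and "normalized_in_agreement \<mu> U"
    and "hilbert_schmidt T"
    and "hs_norm T = 1"
  defines "M \<equiv> \<mu> \<Otimes>\<^sub>M \<mu>"
  shows "(\<forall>\<Phi>\<^sub>1 \<in> L2 M. \<forall>\<Phi>\<^sub>2 \<in> L2 M. AE g in M.
            iterated_integrable M (\<lambda>g' g''. star_kernel U T g g' g'' * \<Phi>\<^sub>1 g' * \<Phi>\<^sub>2 g'') \<and>
            star_product \<mu> U T \<Phi>\<^sub>1 \<Phi>\<^sub>2 g =
              (LINT g'|M. LINT g''|M. star_kernel U T g g' g'' * \<Phi>\<^sub>1 g' * \<Phi>\<^sub>2 g'')) \<and>
         (\<forall>A\<^sub>1 A\<^sub>2. hilbert_schmidt A\<^sub>1 \<and> hilbert_schmidt A\<^sub>2 \<longrightarrow> (AE g in M.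
            iterated_integrable M
              (\<lambda>g' g''. star_kernel U T g g' g'' * dequantize U T A\<^sub>1 g' * dequantize U T A\<^sub>2 g'') \<and>
            dequantize U T (A\<^sub>1 \<circ> A\<^sub>2) g =
              (LINT g'|M. LINT g''|M.
                star_kernel U T g g' g'' * dequantize U T A\<^sub>1 g' * dequantize U T A\<^sub>2 g'')))"
proof -
  from assms(4) have sets: "sets \<mu> = sets borel" by (simp add: haar_measure_def)
  interpret sigma_finite_measure \<mu> by (rule haar_measure_sigma_finite[OF assms(1,4)])
  \<comment> \<open>Normalisation in agreement with U is the case d = 1, where the factor d^2
    disappears.\<close>
  interpret normalized_rep \<mu> U
    using assms(5,6) sets
    by unfold_locales
      (simp_all add: square_integrable_rep_def projective_rep_def normalized_in_agreement_def
        duflo_moore_const_def)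
  note T = assms(7,8)
  note kernel = star_kernel_integral[folded M_def] and L2 = dequantize_L2(1)[folded M_def]
  show ?thesis
  \<comment> \<open>Both claims are verified at every g, which is stronger than almost
    everywhere.\<close>
  proof (intro conjI ballI allI impI AE_I2)
    fix \<Phi>\<^sub>1 \<Phi>\<^sub>2 and g :: "'g \<times> 'g"
    assume "\<Phi>\<^sub>1 \<in> L2 M" "\<Phi>\<^sub>2 \<in> L2 M"
    from kernel[OF T(1) this]
    show "iterated_integrable M (\<lambda>g' g''. star_kernel U T g g' g'' * \<Phi>\<^sub>1 g' * \<Phi>\<^sub>2 g'')"
      and "star_product \<mu> U T \<Phi>\<^sub>1 \<Phi>\<^sub>2 g = (LINT g'|M. LINT g''|M.
        star_kernel U T g g' g'' * \<Phi>\<^sub>1 g' * \<Phi>\<^sub>2 g'')" .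
  next
    fix A\<^sub>1 A\<^sub>2 :: "'h \<Rightarrow> 'h" and g :: "'g \<times> 'g"
    assume "hilbert_schmidt A\<^sub>1 \<and> hilbert_schmidt A\<^sub>2"
    then have A: "hilbert_schmidt A\<^sub>1" "hilbert_schmidt A\<^sub>2" by simp_all
    \<comment> \<open>Quantizing the dequantized operators returns them, so the second claim is an
      instance of the first.\<close>
    have eq: "dequantize U T (A\<^sub>1 \<circ> A\<^sub>2) g =
        star_product \<mu> U T (dequantize U T A\<^sub>1) (dequantize U T A\<^sub>2) g"
      by (simp add: star_product_def quantize_dequantize T A)
    from kernel[OF T(1) L2[OF T(1) A(1)] L2[OF T(1) A(2)]]
    show "iterated_integrable M (\<lambda>g' g''.
        star_kernel U T g g' g'' * dequantize U T A\<^sub>1 g' * dequantize U T A\<^sub>2 g'')"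
      and "dequantize U T (A\<^sub>1 \<circ> A\<^sub>2) g = (LINT g'|M. LINT g''|M.
        star_kernel U T g g' g'' * dequantize U T A\<^sub>1 g' * dequantize U T A\<^sub>2 g'')"
      unfolding eq .
  qed
qed

end
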